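(* Let $A,B\in\mathcal{M}_n$ be positive definite, let $X\in\mathcal{M}_n$, let $r>0$ be a real number and let $|||\cdot|||$ be a unitarily invariant norm on $\mathcal{M}_n$. For $t\in[0,1]$ put $$\phi(t)=|||\,|A^tXB^{1-t}|^r\,|||\cdot|||\,|A^{1-t}XB^t|^r\,|||.$$ Then for every $t\in[0,1]$, $$\phi(t)\leq\phi(t)+\lambda_{\min}\left(\frac{\phi(1/2)+\phi(0)}{2}-\phi\left(\frac14\right)\right)\leq(1-2t_0)\phi(0)+2t_0\,\phi(1/2),$$ where $t_0=\min\{t,1-t\}$ and $\lambda_{\min}=\min\{1-2t_0,\,2t_0\}$.
   Context: $\mathcal{M}_n$ is the algebra of $n\times n$ complex matrices and $|Y|=(Y^*Y)^{1/2}$. A unitarily invariant norm on $\mathcal{M}_n$ is a norm with $|||UXV|||=|||X|||$ for all unitary $U,V$ (equivalently, a symmetric gauge function of the singular values). *)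

theory Defs
  imports Complex_Main "Jordan_Normal_Form.Schur_Decomposition"
begin

definition unitary_mat :: "nat \<Rightarrow> complex mat \<Rightarrow> bool" where
  "unitary_mat n U \<longleftrightarrow>
     U \<in> carrier_mat n n \<and> mat_adjoint U * U = 1\<^sub>m n \<and> U * mat_adjoint U = 1\<^sub>m n"

definition positive_definite_mat :: "nat \<Rightarrow> complex mat \<Rightarrow> bool" where
  "positive_definite_mat n A \<longleftrightarrow>
     A \<in> carrier_mat n n \<and> mat_adjoint A = A \<and>
     (\<forall>v \<in> carrier_vec n. v \<noteq> 0\<^sub>v n \<longrightarrow> 0 < Re ((A *\<^sub>v v) \<bullet>c v))"

definition psd_diagonalization :: "complex mat \<Rightarrow> complex mat \<Rightarrow> (nat \<Rightarrow> real) \<Rightarrow> bool" where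
  "psd_diagonalization A U d \<longleftrightarrow>
     unitary_mat (dim_row A) U \<and> (\<forall>i < dim_row A. 0 \<le> d i) \<and>
     A = U * mat_diag (dim_row A) (\<lambda>i. complex_of_real (d i)) * mat_adjoint U"

text \<open>Real powers by functional calculus, for positive semidefinite \<open>A\<close>: if
  \<open>A = U diag(d) U*\<close> with \<open>U\<close> unitary and \<open>d \<ge> 0\<close>, then \<open>A^t = U diag(d^t) U*\<close>.
  The result does not depend on the diagonalization (lemma \<open>mat_powr_eq\<close> below).
  Since \<open>0 powr t = 0\<close>, the value is the usual one for \<open>t > 0\<close>, and for
  every real \<open>t\<close> if \<open>A\<close> is positive definite (with \<open>A^0 = I\<close>).\<close>

definition mat_powr :: "complex mat \<Rightarrow> real \<Rightarrow> complex mat" where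
  "mat_powr A t = (THE B. \<exists>U d. psd_diagonalization A U d \<and>
     B = U * mat_diag (dim_row A) (\<lambda>i. complex_of_real (d i powr t)) * mat_adjoint U)"

definition mat_abs :: "complex mat \<Rightarrow> complex mat" where
  "mat_abs Y = mat_powr (mat_adjoint Y * Y) (1/2)"

text \<open>Only the restriction of \<open>N\<close> to the \<open>n \<times> n\<close> matrices is relevant.\<close>

definition unitarily_invariant_norm :: "nat \<Rightarrow> (complex mat \<Rightarrow> real) \<Rightarrow> bool" where
  "unitarily_invariant_norm n N \<longleftrightarrow>
     (\<forall>X \<in> carrier_mat n n. 0 \<le> N X) \<and>
     (\<forall>X \<in> carrier_mat n n. N X = 0 \<longleftrightarrow> X = 0\<^sub>m n n) \<and>
     (\<forall>X \<in> carrier_mat n n. \<forall>c. N (c \<cdot>\<^sub>m X) = cmod c * N X) \<and>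
     (\<forall>X \<in> carrier_mat n n. \<forall>Y \<in> carrier_mat n n. N (X + Y) \<le> N X + N Y) \<and>
     (\<forall>X \<in> carrier_mat n n. \<forall>U V. unitary_mat n U \<longrightarrow> unitary_mat n V \<longrightarrow>
        N (U * X * V) = N X)"

definition phi ::
  "(complex mat \<Rightarrow> real) \<Rightarrow> complex mat \<Rightarrow> complex mat \<Rightarrow> complex mat \<Rightarrow> real \<Rightarrow> real \<Rightarrow> real"
where
  "phi N A B X r t =
     N (mat_powr (mat_abs (mat_powr A t * X * mat_powr B (1 - t))) r) *
     N (mat_powr (mat_abs (mat_powr A (1 - t) * X * mat_powr B t)) r)"


lemma mat_adjoint_carrier [simp]:
  "A \<in> carrier_mat n m \<Longrightarrow> mat_adjoint A \<in> carrier_mat m n"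
  unfolding mat_adjoint_def carrier_mat_def by simp

lemma mat_adjoint_index:
  assumes "A \<in> carrier_mat n m" "i < m" "j < n"
  shows "mat_adjoint A $$ (i, j) = conjugate (A $$ (j, i))"
  using assms unfolding mat_adjoint_def by (simp add: mat_of_rows_def)

lemma psd_diagonalization_unique:
  assumes "psd_diagonalization A U d" "psd_diagonalization A V e"
  shows "U * mat_diag (dim_row A) (\<lambda>i. complex_of_real (d i powr t)) * mat_adjoint U =
         V * mat_diag (dim_row A) (\<lambda>i. complex_of_real (e i powr t)) * mat_adjoint V"
proof -
  define n where "n = dim_row A"
  define D where "D f = mat_diag n (\<lambda>i. complex_of_real (f i))" for f :: "nat \<Rightarrow> real"
  define U' V' where "U' = mat_adjoint U" and "V' = mat_adjoint V"
  have [simp]: "D f \<in> carrier_mat n n" for f by (simp add: D_def)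
  have U [simp]: "U \<in> carrier_mat n n" and UU: "U' * U = 1\<^sub>m n" "U * U' = 1\<^sub>m n"
    and V [simp]: "V \<in> carrier_mat n n" and VV: "V' * V = 1\<^sub>m n" "V * V' = 1\<^sub>m n"
    and eq: "U * D d * U' = V * D e * V'"
    using assms by (auto simp: psd_diagonalization_def unitary_mat_def D_def n_def U'_def V'_def)
  have [simp]: "U' \<in> carrier_mat n n" "V' \<in> carrier_mat n n" by (simp_all add: U'_def V'_def)
  have a: "X * Y * Z = X * (Y * Z)"
    if "X \<in> carrier_mat n n" "Y \<in> carrier_mat n n" "Z \<in> carrier_mat n n" for X Y Z :: "complex mat"
    using that by (rule assoc_mult_mat)
  have one [simp]: "1\<^sub>m n * Y = Y" "Y * 1\<^sub>m n = Y"
    if "Y \<in> carrier_mat n n" for Y :: "complex mat"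
    using that by (rule left_mult_one_mat, rule right_mult_one_mat)
  define W where "W = V' * U"
  have W [simp]: "W \<in> carrier_mat n n" by (simp add: W_def mult_carrier_mat[of _ n n])
  have mc [simp]: "X * Y \<in> carrier_mat n n"
    if "X \<in> carrier_mat n n" "Y \<in> carrier_mat n n" for X Y :: "complex mat"
    using that by (rule mult_carrier_mat)
  have VVW: "V' * (V * Y) = Y" and UUW: "U * (U' * Y) = Y" "U' * (U * Y) = Y"
    if "Y \<in> carrier_mat n n" for Y
    using that by (simp_all add: a[symmetric] UU VV)
  have VDW: "V' * (U * D d * U') * U = V' * U * D d"
    by (simp add: a UU)
  have "W * D d = V' * (U * D d * U') * U"
    by (simp only: W_def VDW)
  also have "\<dots> = V' * (V * D e * V') * U" by (simp only: eq)
  also have "\<dots> = (V' * V) * D e * (V' * U)" by (simp add: a)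
  also have "\<dots> = D e * W" using VV by (simp add: W_def)
  finally have WD: "W * D d = D e * W" .
  have l: "(W * D f) $$ (i, j) = W $$ (i, j) * complex_of_real (f j)"
    and r: "(D f * W) $$ (i, j) = complex_of_real (f i) * W $$ (i, j)"
    if "i < n" "j < n" for i j f
    using that by (simp_all add: D_def mat_diag_mult_right[OF W] mat_diag_mult_left[OF W])
  have WDt: "W * D (\<lambda>i. d i powr t) = D (\<lambda>i. e i powr t) * W"
  proof (rule eq_matI)
    fix i j assume "i < dim_row (D (\<lambda>i. e i powr t) * W)" "j < dim_col (D (\<lambda>i. e i powr t) * W)"
    then have ij: "i < n" "j < n" by (simp_all add: D_def mat_diag_def carrier_matD[OF W])
    have "W $$ (i, j) * complex_of_real (d j) = complex_of_real (e i) * W $$ (i, j)"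
      using arg_cong[OF WD, of "\<lambda>M. M $$ (i, j)"] l[OF ij] r[OF ij] by simp
    then have "W $$ (i, j) = 0 \<or> d j = e i" by (simp add: mult.commute)
    then show "(W * D (\<lambda>i. d i powr t)) $$ (i, j) = (D (\<lambda>i. e i powr t) * W) $$ (i, j)"
      using l[OF ij] r[OF ij] by auto
  qed (simp_all add: D_def mat_diag_def carrier_matD[OF W])
  have VW: "V * W = U"
    using a[of V V' U] by (simp add: W_def VV)
  have "U * D (\<lambda>i. d i powr t) * U' = V * (W * D (\<lambda>i. d i powr t)) * U'"
    using a[of V W "D (\<lambda>i. d i powr t)"] VW by simp
  also have "\<dots> = V * (D (\<lambda>i. e i powr t) * W) * U'" by (simp only: WDt)
  also have "\<dots> = V * D (\<lambda>i. e i powr t) * (W * U')" by (simp add: a)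
  also have "W * U' = V'" by (simp add: W_def a UU)
  finally show ?thesis by (simp add: D_def n_def U'_def V'_def)
qed

lemma mat_powr_eq:
  assumes "psd_diagonalization A U d"
  shows "mat_powr A t =
    U * mat_diag (dim_row A) (\<lambda>i. complex_of_real (d i powr t)) * mat_adjoint U"
  unfolding mat_powr_def
proof (rule the_equality)
  show "\<exists>U' d'. psd_diagonalization A U' d' \<and>
      U * mat_diag (dim_row A) (\<lambda>i. complex_of_real (d i powr t)) * mat_adjoint U =
      U' * mat_diag (dim_row A) (\<lambda>i. complex_of_real (d' i powr t)) * mat_adjoint U'"
    using assms by blast
next
  fix B assume "\<exists>U' d'. psd_diagonalization A U' d' \<and>
      B = U' * mat_diag (dim_row A) (\<lambda>i. complex_of_real (d' i powr t)) * mat_adjoint U'"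
  then obtain U' d' where "psd_diagonalization A U' d'"
    and "B = U' * mat_diag (dim_row A) (\<lambda>i. complex_of_real (d' i powr t)) * mat_adjoint U'"
    by blast
  then show "B = U * mat_diag (dim_row A) (\<lambda>i. complex_of_real (d i powr t)) * mat_adjoint U"
    using psd_diagonalization_unique[OF _ assms] by simp
qed

end

theory Submission
  imports Defs "Jordan_Normal_Form.Spectral_Radius" "HOL-Analysis.Convex"
begin

text \<open>
The function \<open>\<phi>\<close> is symmetric about \<open>1/2\<close> and convex on \<open>[0, 1]\<close>. Both inequalities follow from this:
the first because the gap \<open>(\<phi>(1/2) + \<phi>(0))/2 - \<phi>(1/4)\<close> is nonnegative, the second by comparing
\<open>\<phi>(t0)\<close> with the chord over \<open>[0, 1/4]\<close> or over \<open>[1/4, 1/2]\<close>; that chord lies below the chord over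
\<open>[0, 1/2]\<close> by exactly \<open>2 lmin\<close> times the gap, and only \<open>lmin\<close> times the gap is claimed.

Convexity comes from the log-convexity at midpoints of \<open>f(u) = |||  |A^u X B^(1-u)|^r |||\<close>. For
\<open>h = (t - s)/2\<close> and \<open>Y = A^s X B^(1-t)\<close> the matrices at the midpoint and at the two ends are
\<open>A^h Y B^h\<close>, \<open>A^(2h) Y\<close> and \<open>Y B^(2h)\<close>, so the claim \<open>f((s+t)/2)^2 \<le> f(s) f(t)\<close> is the Cauchy-Schwarz
inequality \<open>||| |C Y D|^r |||^2 \<le> ||| |C^2 Y|^r ||| ||| |Y D^2|^r |||\<close> of Bhatia and Davis
(\<open>norm_Cauchy_Schwarz\<close>). A midpoint convex function that is bounded above lies below its chords
(\<open>bounded_midpoint_convex_below_chord\<close>), and a crude bound for the singular values bounds \<open>\<phi>\<close>.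

The Cauchy-Schwarz inequality has two ingredients. The first
(\<open>singular_value_log_majorization\<close>) compares products of the \<open>k\<close> largest singular values:
the squared product for \<open>C Y D\<close> is at most the product of those for \<open>C^2 Y\<close> and \<open>Y D^2\<close>. In place of exterior
powers its proof uses \<open>k \<times> k\<close> determinants of products of rectangular matrices and the
Cauchy-Binet formula, which gives a Cauchy-Schwarz inequality for \<open>det (P* R)\<close> and the bound of
\<open>det (Z* H Z)\<close> by \<open>det (Z* Z)\<close> times the product of the \<open>k\<close> largest eigenvalues of \<open>H\<close>. The second
(\<open>gauge_le_if_log_majorized\<close>) says that a symmetric gauge function respects
weak log-majorization, by a multiplicative version of the transfers of Hardy, Littlewood and Polya.
Because log-majorization is stable under \<open>x \<mapsto> x^r\<close>, every exponent \<open>r > 0\<close> is covered at once.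
\<close>

section \<open>Adjoints and unitary matrices\<close>

lemma mat_adjoint_dim [simp]: "dim_row (mat_adjoint A) = dim_col A" "dim_col (mat_adjoint A) = dim_row A"
  by (simp_all add: mat_adjoint_def)

lemma mat_adjoint_adjoint [simp]: "mat_adjoint (mat_adjoint A) = (A :: complex mat)"
  by (rule eq_matI) (simp_all add: mat_adjoint_index[of _ "dim_col A" "dim_row A"]
      mat_adjoint_index[of _ "dim_row A" "dim_col A"] mat_adjoint_carrier[of _ "dim_row A" "dim_col A"])

lemma square_mult_carrier [simp]:
  "A \<in> carrier_mat n n \<Longrightarrow> B \<in> carrier_mat n n \<Longrightarrow> A * B \<in> carrier_mat n n"
  by (rule mult_carrier_mat)

lemma mat_adjoint_mult:
  fixes A B :: "complex mat"
  assumes A: "A \<in> carrier_mat n m" and B: "B \<in> carrier_mat m p"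
  shows "mat_adjoint (A * B) = mat_adjoint B * mat_adjoint A"
proof (rule eq_matI)
  fix i j assume "i < dim_row (mat_adjoint B * mat_adjoint A)" "j < dim_col (mat_adjoint B * mat_adjoint A)"
  then have ij: "i < p" "j < n" using A B by simp_all
  have AB: "A * B \<in> carrier_mat n p" using A B by simp
  show "mat_adjoint (A * B) $$ (i, j) = (mat_adjoint B * mat_adjoint A) $$ (i, j)"
    using A B ij by (simp add: mat_adjoint_index[OF AB ij] scalar_prod_def
        mat_adjoint_index[OF A] mat_adjoint_index[OF B] mult.commute)
qed (use A B in simp_all)

lemma mat_adjoint_diag: "mat_adjoint (mat_diag n f) = mat_diag n (\<lambda>i. cnj (f i))"
  by (rule eq_matI) (auto simp: mat_diag_def mat_adjoint_index[of _ n n])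

lemma mat_adjoint_diag_real [simp]:
  "mat_adjoint (mat_diag n (\<lambda>i. complex_of_real (d i))) = mat_diag n (\<lambda>i. complex_of_real (d i))"
  by (simp add: mat_adjoint_diag)

lemma mat_adjoint_one [simp]: "mat_adjoint (1\<^sub>m n :: complex mat) = 1\<^sub>m n"
  using mat_adjoint_diag[of n "\<lambda>_. 1"] by simp

lemma adjoint_mult_self_index:
  assumes "P \<in> carrier_mat n k" "i < k"
  shows "(mat_adjoint P * P) $$ (i, i) = complex_of_real (\<Sum>l<n. (cmod (P $$ (l, i)))\<^sup>2)"
  using assms
  by (simp add: scalar_prod_def mat_adjoint_index[of _ n k] complex_norm_square
      mult.commute[of "cnj _"] atLeast0LessThan del: of_real_power)

lemma unitary_matD:
  assumes "unitary_mat n U"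
  shows "U \<in> carrier_mat n n" "mat_adjoint U \<in> carrier_mat n n"
    "mat_adjoint U * U = 1\<^sub>m n" "U * mat_adjoint U = 1\<^sub>m n"
  using assms by (auto simp: unitary_mat_def)

lemma unitary_matI:
  assumes "U \<in> carrier_mat n n" "mat_adjoint U * U = 1\<^sub>m n"
  shows "unitary_mat n U"
  using assms mat_mult_left_right_inverse[of "mat_adjoint U" n U] by (simp add: unitary_mat_def)

lemma unitary_mat_adjoint:
  "unitary_mat n U \<Longrightarrow> unitary_mat n (mat_adjoint U)"
  by (auto simp: unitary_mat_def)

lemma unitary_mat_mult:
  assumes U: "unitary_mat n U" and V: "unitary_mat n V"
  shows "unitary_mat n (U * V)"
proof (rule unitary_matI)
  note [simp] = unitary_matD(1,2)[OF U] unitary_matD(1,2)[OF V]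
  show "U * V \<in> carrier_mat n n" by simp
  have "mat_adjoint (U * V) * (U * V) = mat_adjoint V * (mat_adjoint U * (U * V))"
    by (simp add: mat_adjoint_mult[of U n n V n] assoc_mult_mat[of _ n n _ n _ n] mult_carrier_mat[of _ n n])
  also have "mat_adjoint U * (U * V) = (mat_adjoint U * U) * V"
    by (simp add: assoc_mult_mat[of _ n n _ n _ n])
  finally show "mat_adjoint (U * V) * (U * V) = 1\<^sub>m n"
    by (simp add: unitary_matD[OF U] unitary_matD[OF V] left_mult_one_mat[of _ n n])
qed

lemma unitary_cancel:
  fixes Y :: "complex mat"
  assumes U: "unitary_mat n U" and Y: "Y \<in> carrier_mat n m"
  shows "mat_adjoint U * (U * Y) = Y" "U * (mat_adjoint U * Y) = Y"
  using unitary_matD[OF U] Y by (simp_all flip: assoc_mult_mat[of _ n n _ n _ m])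

section \<open>The spectral theorem for Hermitian matrices\<close>

text \<open>Extend \<open>v\<close> to a basis, orthogonalise it by Gram-Schmidt (which keeps the first vector) and
normalise the columns; the factor \<open>c\<close> is the normalisation of \<open>v\<close>.\<close>
lemma unitary_with_first_col:
  fixes v :: "complex vec"
  assumes v: "v \<in> carrier_vec n" and v0: "v \<noteq> 0\<^sub>v n"
  shows "\<exists>U c. unitary_mat n U \<and> col U 0 = c \<cdot>\<^sub>v v"
proof -
  have n: "0 < n" using v v0 by (metis carrier_vecD eq_vecI gr0I less_nat_zero_code zero_carrier_vec)
  define b where "b = basis_completion v"
  define ws where "ws = gram_schmidt n b"
  define W where "W = mat_of_cols n ws"
  interpret cof_vec_space n "TYPE(complex)" .
  from basis_completion[OF v v0, folded b_def]
  have dist_b: "distinct b" 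
    and indep: "\<not> lin_dep (set b)" and b: "set b \<subseteq> carrier_vec n" and hdb: "hd b = v" 
    and len_b: "length b = n" by auto
  from hdb len_b n obtain vs where bv: "b = v # vs" by (cases b, auto)
  from gram_schmidt_result[OF b dist_b indep refl, folded ws_def]
  have ws: "set ws \<subseteq> carrier_vec n" "corthogonal ws" "length ws = n" 
    by (auto simp: len_b)
  from gram_schmidt_hd[OF v, of vs, folded bv] have hdws: "hd ws = v" unfolding ws_def .
  have orth_W: "corthogonal_mat W" using orthogonal_mat_of_cols ws unfolding W_def .
  have W [simp]: "W \<in> carrier_mat n n"
    using ws unfolding W_def using mat_of_cols_carrier(1)[of n ws] by auto
  define s where "s i = (\<Sum>l<n. (cmod (W $$ (l, i)))\<^sup>2)" for i
  have diag: "diagonal_mat (mat_adjoint W * W)" and nz: "\<And>i. i < n \<Longrightarrow> (mat_adjoint W * W) $$ (i, i) \<noteq> 0"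
    using orth_W carrier_matD[OF W] unfolding corthogonal_mat_def Let_def by metis+
  have WW: "mat_adjoint W * W = mat_diag n (\<lambda>i. complex_of_real (s i))"
  proof (rule eq_matI)
    fix i j assume "i < dim_row (mat_diag n (\<lambda>i. complex_of_real (s i)))"
      "j < dim_col (mat_diag n (\<lambda>i. complex_of_real (s i)))"
    then have ij: "i < n" "j < n" by (simp_all add: mat_diag_def)
    show "(mat_adjoint W * W) $$ (i, j) = mat_diag n (\<lambda>i. complex_of_real (s i)) $$ (i, j)"
    proof (cases "i = j")
      case True
      then show ?thesis
        using adjoint_mult_self_index[OF W ij(1)] ij by (simp add: mat_diag_def s_def)
    next
      case False
      then show ?thesis
        using diag ij carrier_matD[OF W] unfolding diagonal_mat_def by (simp add: mat_diag_def)
    qed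
  qed (simp_all add: mat_diag_def W[THEN carrier_matD(1)] W[THEN carrier_matD(2)])
  have s: "s i > 0" if "i < n" for i
    using nz[OF that] adjoint_mult_self_index[OF W that] unfolding s_def[symmetric]
    by (metis of_real_eq_0_iff order_le_less s_def sum_nonneg zero_le_power2)
  define D where "D = mat_diag n (\<lambda>i. complex_of_real (1 / sqrt (s i)))"
  have D [simp]: "D \<in> carrier_mat n n" "mat_adjoint D = D"
    unfolding D_def by (simp, rule mat_adjoint_diag_real)
  have "mat_adjoint (W * D) * (W * D) = D * ((mat_adjoint W * W) * D)"
    by (simp add: mat_adjoint_mult[of _ n n _ n] assoc_mult_mat[of _ n n _ n _ n])
  also have "\<dots> = mat_diag n (\<lambda>i. complex_of_real (1 / sqrt (s i) * (s i * (1 / sqrt (s i)))))"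
    by (simp only: WW D_def mat_diag_diag of_real_mult)
  also have "\<dots> = 1\<^sub>m n"
  proof (rule eq_matI)
    have "1 / sqrt (s i) * (s i * (1 / sqrt (s i))) = 1" if "i < n" for i
      using s[OF that] by (simp add: field_simps)
    then show "mat_diag n (\<lambda>i. complex_of_real (1 / sqrt (s i) * (s i * (1 / sqrt (s i))))) $$ (i, j) = 1\<^sub>m n $$ (i, j)"
      if "i < dim_row (1\<^sub>m n)" "j < dim_col (1\<^sub>m n)" for i j
      using that by (simp only: mat_diag_def) auto
  qed (simp_all add: mat_diag_def)
  finally have "unitary_mat n (W * D)"
    by (intro unitary_matI mult_carrier_mat[of _ n n]) auto
  moreover have "col (W * D) 0 = complex_of_real (1 / sqrt (s 0)) \<cdot>\<^sub>v v"
  proof (rule eq_vecI)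
    fix i assume "i < dim_vec (complex_of_real (1 / sqrt (s 0)) \<cdot>\<^sub>v v)"
    then have i: "i < n" using v by simp
    have "W $$ (i, 0) = v $ i"
      using i n ws hdws by (cases ws) (auto simp: W_def mat_of_cols_index)
    then show "col (W * D) 0 $ i = (complex_of_real (1 / sqrt (s 0)) \<cdot>\<^sub>v v) $ i"
      using i n v by (simp add: D_def mat_diag_mult_right[OF W])
  qed (use v carrier_matD[OF W] in simp)
  ultimately show ?thesis by blast
qed

lemma mat_adjoint_four_block:
  assumes "A \<in> carrier_mat a a" "D \<in> carrier_mat d d"
  shows "mat_adjoint (four_block_mat A (0\<^sub>m a d) (0\<^sub>m d a) D) =
    four_block_mat (mat_adjoint A) (0\<^sub>m a d) (0\<^sub>m d a) (mat_adjoint D :: complex mat)"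
proof -
  have c: "four_block_mat A (0\<^sub>m a d) (0\<^sub>m d a) D \<in> carrier_mat (a + d) (a + d)"
    using assms by simp
  show ?thesis
    by (rule eq_matI) (use assms in \<open>auto simp: mat_adjoint_index[OF c] mat_adjoint_index[OF assms(1)]
      mat_adjoint_index[OF assms(2)]\<close>)
qed

lemma mult_block_diag:
  assumes "A \<in> carrier_mat a a" "D \<in> carrier_mat d d" "A' \<in> carrier_mat a a" "D' \<in> carrier_mat d d"
  shows "four_block_mat A (0\<^sub>m a d) (0\<^sub>m d a) D * four_block_mat A' (0\<^sub>m a d) (0\<^sub>m d a) D' =
    four_block_mat (A * A') (0\<^sub>m a d) (0\<^sub>m d a) (D * D' :: complex mat)"
  by (subst mult_four_block_mat[of _ a a _ d _ d _ _ a _ d]) (use assms in auto)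

text \<open>Induction on the dimension. In an orthonormal basis that begins with an eigenvector, the first
column of the matrix is a multiple of the first unit vector, hence by symmetry also the first row,
and the remaining block is Hermitian of smaller size.\<close>
theorem hermitian_diagonalization:
  assumes "A \<in> carrier_mat n n" "mat_adjoint A = A"
  shows "\<exists>U d. unitary_mat n U \<and> A = U * mat_diag n (\<lambda>i. complex_of_real (d i)) * mat_adjoint U"
  using assms
proof (induction n arbitrary: A)
  case 0
  have "unitary_mat 0 (1\<^sub>m 0)" by (simp add: unitary_mat_def)
  moreover have "A = 1\<^sub>m 0 * mat_diag 0 (\<lambda>i. complex_of_real 0) * mat_adjoint (1\<^sub>m 0)"
    using 0 by (intro eq_matI) (auto simp: mat_diag_def)
  ultimately show ?case by (intro exI[of _ "1\<^sub>m 0"] exI[of _ "\<lambda>_. 0"]) auto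
next
  case (Suc n A)
  let ?n = "Suc n"
  have A [simp]: "A \<in> carrier_mat ?n ?n" by fact
  obtain e where "e \<in> spectrum A" using spectrum_non_empty[OF A] by auto
  then obtain v where v: "v \<in> carrier_vec ?n" "v \<noteq> 0\<^sub>v ?n" "A *\<^sub>v v = e \<cdot>\<^sub>v v"
    using A by (auto simp: spectrum_def eigenvalue_def eigenvector_def)
  obtain U c where U: "unitary_mat ?n U" and c: "col U 0 = c \<cdot>\<^sub>v v"
    using unitary_with_first_col[OF v(1,2)] by blast
  note Uc [simp] = unitary_matD(1,2)[OF U]
  define M where "M = mat_adjoint U * (A * U)"
  have M [simp]: "M \<in> carrier_mat ?n ?n" by (simp add: M_def mult_carrier_mat[of _ ?n ?n])
  have Mh: "mat_adjoint M = M"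
    using Suc.prems by (simp add: M_def mat_adjoint_mult[of _ ?n ?n _ ?n] assoc_mult_mat[of _ ?n ?n _ ?n _ ?n])
  have AUM: "A = U * M * mat_adjoint U"
    using unitary_matD(4)[OF U] by (simp add: M_def unitary_cancel[OF U, where m = ?n] right_mult_one_mat[of _ ?n ?n]
        assoc_mult_mat[of _ ?n ?n _ ?n _ ?n])
  have "col (A * U) 0 = e \<cdot>\<^sub>v col U 0"
    using v by (simp add: col_mult2[of _ ?n ?n _ ?n] c mult_mat_vec[of _ ?n ?n] smult_smult_assoc mult.commute)
  then have M0: "M $$ (i, 0) = (if i = 0 then e else 0)" if "i < ?n" for i
  proof -
    have "M $$ (i, 0) = row (mat_adjoint U) i \<bullet> (e \<cdot>\<^sub>v col U 0)"
      using that \<open>col (A * U) 0 = _\<close> by (simp add: M_def Uc[THEN carrier_matD(1)] Uc[THEN carrier_matD(2)])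
    also have "\<dots> = e * (row (mat_adjoint U) i \<bullet> col U 0)"
      using that by (intro scalar_prod_smult_distrib[of _ ?n])
        (auto intro!: carrier_vecI simp: Uc[THEN carrier_matD(1)] Uc[THEN carrier_matD(2)])
    also have "row (mat_adjoint U) i \<bullet> col U 0 = (mat_adjoint U * U) $$ (i, 0)"
      using that by (simp add: Uc[THEN carrier_matD(1)] Uc[THEN carrier_matD(2)])
    finally show ?thesis using that by (simp add: unitary_matD(3)[OF U])
  qed
  have Mh': "M $$ (i, j) = cnj (M $$ (j, i))" if "i < ?n" "j < ?n" for i j
    using mat_adjoint_index[OF M that] by (simp add: Mh)
  have e: "e = complex_of_real (Re e)"
    using Mh'[of 0 0] M0[of 0] by (simp add: complex_eq_iff)
  define M3 where "M3 = mat n n (\<lambda>(i, j). M $$ (Suc i, Suc j))"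
  have M3 [simp]: "M3 \<in> carrier_mat n n" by (simp add: M3_def)
  have M0': "M $$ (0, j) = (if j = 0 then e else 0)" if "j < ?n" for j
    using M0[OF that] Mh'[OF zero_less_Suc that] e by (metis complex_cnj_complex_of_real complex_cnj_zero)
  have "mat_adjoint M3 = M3"
  proof (rule eq_matI)
    fix i j assume "i < dim_row M3" "j < dim_col M3"
    then have "i < n" "j < n" by (simp_all add: M3_def)
    then show "mat_adjoint M3 $$ (i, j) = M3 $$ (i, j)"
      using Mh'[of "Suc j" "Suc i"] by (simp add: mat_adjoint_index[OF M3]) (simp add: M3_def)
  qed (simp_all add: M3_def)
  then obtain V d where V: "unitary_mat n V"
    and M3V: "M3 = V * mat_diag n (\<lambda>i. complex_of_real (d i)) * mat_adjoint V"
    using Suc.IH[OF M3] by blast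
  note [simp] = unitary_matD(1,2)[OF V]
  define E where "E = (mat_diag 1 (\<lambda>_. complex_of_real (Re e)))"
  have E [simp]: "E \<in> carrier_mat 1 1" by (simp add: E_def)
  let ?blk = "\<lambda>P Q. four_block_mat P (0\<^sub>m 1 n) (0\<^sub>m n 1) Q"
  define d' where "d' i = (case i of 0 \<Rightarrow> Re e | Suc j \<Rightarrow> d j)" for i
  have MM: "M = ?blk E M3"
  proof (rule eq_matI)
    fix i j assume "i < dim_row (?blk E M3)" "j < dim_col (?blk E M3)"
    then have "i < ?n" "j < ?n" by (simp_all add: E_def M3_def mat_diag_def)
    then show "M $$ (i, j) = ?blk E M3 $$ (i, j)"
      using M0 M0' e by (cases i; cases j) (simp_all add: E_def mat_diag_def M3_def)
  qed (simp_all add: E_def M3_def mat_diag_def carrier_matD[OF M])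
  define V' where "V' = ?blk (1\<^sub>m 1) V"
  have V'c [simp]: "V' \<in> carrier_mat ?n ?n"
    unfolding V'_def using four_block_carrier_mat[of "1\<^sub>m 1" 1 1 V n n] by simp
  have V'a: "mat_adjoint V' = ?blk (1\<^sub>m 1) (mat_adjoint V)"
    unfolding V'_def by (subst mat_adjoint_four_block) auto
  have V': "unitary_mat ?n V'"
  proof (rule unitary_matI)
    have "mat_adjoint V' * V' = ?blk (1\<^sub>m 1 * 1\<^sub>m 1) (mat_adjoint V * V)"
      unfolding V'a unfolding V'_def by (rule mult_block_diag) auto
    then show "mat_adjoint V' * V' = 1\<^sub>m ?n"
      by (simp add: unitary_matD[OF V])
  qed simp
  let ?D = "mat_diag n (\<lambda>i. complex_of_real (d i))"
  let ?D' = "mat_diag ?n (\<lambda>i. complex_of_real (d' i))"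
  have D': "?D' = ?blk E ?D"
  proof (rule eq_matI)
    fix i j assume "i < dim_row (?blk E ?D)" "j < dim_col (?blk E ?D)"
    then have "i < ?n" "j < ?n" by (simp_all add: E_def mat_diag_def)
    then show "?D' $$ (i, j) = ?blk E ?D $$ (i, j)"
      by (cases i; cases j) (auto simp: E_def mat_diag_def d'_def)
  qed (simp_all add: E_def mat_diag_def)
  have "V' * ?D' = ?blk (1\<^sub>m 1 * E) (V * ?D)"
    unfolding D' V'_def by (rule mult_block_diag[OF _ _ E]) simp_all
  moreover have "?blk E (V * ?D) * mat_adjoint V' = ?blk (E * 1\<^sub>m 1) (V * ?D * mat_adjoint V)"
    unfolding V'a by (rule mult_block_diag[OF E]) simp_all
  ultimately have "V' * ?D' * mat_adjoint V' = M"
    by (simp only: left_mult_one_mat[OF E] right_mult_one_mat[OF E] MM M3V)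
  then have "A = (U * V') * ?D' * mat_adjoint (U * V')"
    unfolding AUM \<open>V' * ?D' * mat_adjoint V' = M\<close>[symmetric]
    by (simp add: mat_adjoint_mult[of _ ?n ?n _ ?n] assoc_mult_mat[of _ ?n ?n _ ?n _ ?n])
  moreover have "unitary_mat ?n (U * V')" by (rule unitary_mat_mult[OF U V'])
  ultimately show ?case by blast
qed

section \<open>Determinants of rectangular products\<close>

text \<open>Maps from \<open>{0..<k}\<close> to \<open>{0..<n}\<close>, fixed to be the identity outside \<open>{0..<k}\<close>. This normalisation makes
the set finite and is the index set of the multilinear expansion \<open>det_linear_rows_sum\<close>.\<close>
definition row_choices :: "nat \<Rightarrow> nat \<Rightarrow> (nat \<Rightarrow> nat) set" where
  "row_choices k n = {f. (\<forall>i \<in> {0..<k}. f i \<in> {0..<n}) \<and> (\<forall>i. i \<notin> {0..<k} \<longrightarrow> f i = i)}"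

definition rows_of :: "nat \<Rightarrow> 'a mat \<Rightarrow> (nat \<Rightarrow> nat) \<Rightarrow> 'a mat" where
  "rows_of k B f = mat k k (\<lambda>(i, j). B $$ (f i, j))"

lemma rows_of_carrier [simp]: "rows_of k B f \<in> carrier_mat k k"
  by (simp add: rows_of_def)

lemma row_choices_permute:
  assumes p: "p permutes {0..<k}"
  shows "bij_betw (\<lambda>f. f \<circ> p) (row_choices k n) (row_choices k n)"
proof (rule bij_betwI[where g = "\<lambda>f. f \<circ> Hilbert_Choice.inv p"])
  have q: "Hilbert_Choice.inv p permutes {0..<k}" by (rule permutes_inv[OF p])
  have c: "f \<circ> p \<in> row_choices k n" if "f \<in> row_choices k n" "p permutes {0..<k}" for f p
    using that permutes_in_image[OF that(2)] permutes_not_in[OF that(2)] by (auto simp: row_choices_def)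
  show "(\<lambda>f. f \<circ> p) \<in> row_choices k n \<rightarrow> row_choices k n"
    "(\<lambda>f. f \<circ> Hilbert_Choice.inv p) \<in> row_choices k n \<rightarrow> row_choices k n"
    using c p q by auto
  show "(f \<circ> p) \<circ> Hilbert_Choice.inv p = f" "(f \<circ> Hilbert_Choice.inv p) \<circ> p = f" for f
    by (simp_all add: fun_eq_iff permutes_inverses[OF p])
qed

text \<open>The Cauchy-Binet formula with the sum over \<open>k\<close>-element subsets of rows replaced by a sum over all
maps, which counts each subset \<open>k!\<close> times (maps that are not injective contribute zero). Expanding
the rows of \<open>A B\<close> gives a sum in which \<open>A\<close> enters by a single product of entries; averaging over the
substitutions \<open>f \<circ> p\<close> turns this product into a determinant, because permuting the chosen rows of
\<open>B\<close> multiplies the determinant by the sign of \<open>p\<close>.\<close>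
theorem det_mult_rectangular:
  fixes A B :: "'a :: {comm_ring_1, ring_char_0} mat"
  assumes A: "A \<in> carrier_mat k n" and B: "B \<in> carrier_mat n k"
  shows "fact k * det (A * B) =
    (\<Sum>f \<in> row_choices k n. det (mat k k (\<lambda>(i, j). A $$ (i, f j))) * det (rows_of k B f))"
proof -
  let ?F = "row_choices k n" and ?P = "{p. p permutes {0..<k}}"
  have "det (A * B) = (\<Sum>f \<in> ?F. det (mat\<^sub>r k k (\<lambda>i. A $$ (i, f i) \<cdot>\<^sub>v row B (f i))))"
    unfolding mat_mul_finsum_alt[OF A B] row_choices_def
    by (rule det_linear_rows_sum) (use A B in auto)
  also have "\<dots> = (\<Sum>f \<in> ?F. (\<Prod>i \<in> {0..<k}. A $$ (i, f i)) * det (rows_of k B f))"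
  proof (rule sum.cong[OF refl])
    fix f assume f: "f \<in> ?F"
    have "mat\<^sub>r k k (\<lambda>i. row B (f i)) = rows_of k B f"
      using f B by (intro eq_matI) (auto simp: rows_of_def row_choices_def)
    moreover have "det (mat\<^sub>r k k (\<lambda>i. A $$ (i, f i) \<cdot>\<^sub>v row B (f i))) =
        (\<Prod>i \<in> {0..<k}. A $$ (i, f i)) * det (mat\<^sub>r k k (\<lambda>i. row B (f i)))"
      by (rule det_rows_mul) (use B in auto)
    ultimately show "det (mat\<^sub>r k k (\<lambda>i. A $$ (i, f i) \<cdot>\<^sub>v row B (f i))) =
        (\<Prod>i \<in> {0..<k}. A $$ (i, f i)) * det (rows_of k B f)" by simp
  qed
  finally have d: "det (A * B) = (\<Sum>f \<in> ?F. (\<Prod>i \<in> {0..<k}. A $$ (i, f i)) * det (rows_of k B f))" .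
  have perm: "det (A * B) =
      (\<Sum>f \<in> ?F. (signof p * (\<Prod>i \<in> {0..<k}. A $$ (i, f (p i)))) * det (rows_of k B f))"
    if p: "p permutes {0..<k}" for p
  proof -
    have r: "rows_of k B (f \<circ> p) = mat k k (\<lambda>(i, j). rows_of k B f $$ (p i, j))" for f
      using permutes_in_image[OF p] by (intro eq_matI) (auto simp: rows_of_def)
    have "det (rows_of k B (f \<circ> p)) = signof p * det (rows_of k B f)" for f
      unfolding r by (rule det_permute_rows[OF _ p]) simp
    then have "(\<Sum>f \<in> ?F. (\<Prod>i \<in> {0..<k}. A $$ (i, (f \<circ> p) i)) * det (rows_of k B (f \<circ> p))) =
      (\<Sum>f \<in> ?F. (signof p * (\<Prod>i \<in> {0..<k}. A $$ (i, f (p i)))) * det (rows_of k B f))"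
      by (intro sum.cong) (simp_all add: mult_ac)
    then show ?thesis
      unfolding d using sum.reindex_bij_betw[OF row_choices_permute[OF p, of n],
        of "\<lambda>f. (\<Prod>i \<in> {0..<k}. A $$ (i, f i)) * det (rows_of k B f)"] by simp
  qed
  have "fact k * det (A * B) = (\<Sum>p \<in> ?P. det (A * B))"
    by (simp add: card_permutations[of "{0..<k}" k])
  also have "\<dots> = (\<Sum>p \<in> ?P. \<Sum>f \<in> ?F. (signof p * (\<Prod>i \<in> {0..<k}. A $$ (i, f (p i)))) * det (rows_of k B f))"
    by (rule sum.cong[OF refl]) (use perm in auto)
  also have "\<dots> = (\<Sum>f \<in> ?F. (\<Sum>p \<in> ?P. signof p * (\<Prod>i \<in> {0..<k}. A $$ (i, f (p i)))) * det (rows_of k B f))"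
    by (subst sum.swap) (simp add: sum_distrib_right)
  also have "\<dots> = (\<Sum>f \<in> ?F. det (mat k k (\<lambda>(i, j). A $$ (i, f j))) * det (rows_of k B f))"
  proof (intro sum.cong refl arg_cong2[where f = "(*)"])
    fix f
    show "(\<Sum>p \<in> ?P. signof p * (\<Prod>i \<in> {0..<k}. A $$ (i, f (p i)))) = det (mat k k (\<lambda>(i, j). A $$ (i, f j)))"
      unfolding det_def'[OF mat_carrier]
      by (intro sum.cong refl arg_cong2[where f = "(*)"] prod.cong) (auto simp: permutes_in_image)
  qed
  finally show ?thesis .
qed

lemma det_mat_adjoint:
  assumes A: "A \<in> carrier_mat k k"
  shows "det (mat_adjoint A) = cnj (det A)"
proof -
  have "det (mat_adjoint A) = det (transpose_mat (mat_adjoint A))"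
    using A by (simp add: det_transpose[of _ k])
  also have "\<dots> = cnj (det A)"
    using A unfolding det_def'[OF A] det_def'[OF transpose_carrier_mat[THEN iffD2, OF mat_adjoint_carrier[OF A]]]
    by (auto simp: mat_adjoint_index[OF A] permutes_in_image intro!: sum.cong prod.cong)
  finally show ?thesis .
qed

lemma det_adjoint_mult:
  assumes P: "P \<in> carrier_mat n k" and R: "R \<in> carrier_mat n k"
  shows "fact k * det (mat_adjoint P * R) =
    (\<Sum>f \<in> row_choices k n. cnj (det (rows_of k P f)) * det (rows_of k R f))"
proof -
  have "mat k k (\<lambda>(i, j). mat_adjoint P $$ (i, f j)) = mat_adjoint (rows_of k P f)"
    if "f \<in> row_choices k n" for f
  proof (rule eq_matI)
    fix i j assume "i < dim_row (mat_adjoint (rows_of k P f))" "j < dim_col (mat_adjoint (rows_of k P f))"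
    then have ij: "i < k" "j < k" by (simp_all add: rows_of_def)
    then have "f j < n" using that by (simp add: row_choices_def)
    then show "mat k k (\<lambda>(i, j). mat_adjoint P $$ (i, f j)) $$ (i, j) = mat_adjoint (rows_of k P f) $$ (i, j)"
      using ij by (simp add: mat_adjoint_index[OF P] mat_adjoint_index[OF rows_of_carrier])
        (simp add: rows_of_def)
  qed (simp_all add: rows_of_def)
  then show ?thesis
    unfolding det_mult_rectangular[OF mat_adjoint_carrier[OF P] R]
    by (intro sum.cong) (simp_all add: det_mat_adjoint[of _ k])
qed

lemma det_gram:
  assumes P: "P \<in> carrier_mat n k"
  shows "det (mat_adjoint P * P) =
    complex_of_real ((\<Sum>f \<in> row_choices k n. (cmod (det (rows_of k P f)))\<^sup>2) / fact k)"
proof -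
  have "fact k * det (mat_adjoint P * P) =
      complex_of_real (\<Sum>f \<in> row_choices k n. (cmod (det (rows_of k P f)))\<^sup>2)"
    unfolding det_adjoint_mult[OF P P] by (simp add: complex_norm_square mult.commute del: of_real_power)
  then show ?thesis by (simp add: field_simps)
qed

text \<open>By Cauchy-Binet \<open>det (P* R)\<close> is a scalar product of the vectors of \<open>k \<times> k\<close> minors of \<open>P\<close> and \<open>R\<close>.\<close>
lemma det_adjoint_mult_Cauchy_Schwarz:
  assumes P: "P \<in> carrier_mat n k" and R: "R \<in> carrier_mat n k"
  shows "(cmod (det (mat_adjoint P * R)))\<^sup>2 \<le>
    Re (det (mat_adjoint P * P)) * Re (det (mat_adjoint R * R))"
proof -
  let ?p = "\<lambda>f. cmod (det (rows_of k P f))" and ?r = "\<lambda>f. cmod (det (rows_of k R f))"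
  have "fact k * cmod (det (mat_adjoint P * R)) = cmod (fact k * det (mat_adjoint P * R))"
    by (simp add: norm_mult)
  also have "\<dots> \<le> (\<Sum>f \<in> row_choices k n. ?p f * ?r f)"
    unfolding det_adjoint_mult[OF P R] by (rule order_trans[OF norm_sum]) (simp add: norm_mult)
  finally have "(fact k * cmod (det (mat_adjoint P * R)))\<^sup>2 \<le> (\<Sum>f \<in> row_choices k n. ?p f * ?r f)\<^sup>2"
    by (intro power_mono) auto
  also have "\<dots> \<le> (\<Sum>f \<in> row_choices k n. (?p f)\<^sup>2) * (\<Sum>f \<in> row_choices k n. (?r f)\<^sup>2)"
    by (rule Cauchy_Schwarz_ineq_sum)
  finally show ?thesis
    unfolding det_gram[OF P] det_gram[OF R] Re_complex_of_real
    by (simp add: field_simps power2_eq_square)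
qed

text \<open>Removing the largest index \<open>m\<close> of \<open>S\<close>: since \<open>S\<close> lies in \<open>{..m}\<close>, this index is at least \<open>card S - 1\<close>.\<close>
lemma prod_antimono_le:
  fixes c :: "nat \<Rightarrow> real"
  assumes "S \<subseteq> {..<n}" "\<And>i. i < n \<Longrightarrow> 0 \<le> c i" "\<And>i j. i \<le> j \<Longrightarrow> j < n \<Longrightarrow> c j \<le> c i"
  shows "(\<Prod>i \<in> S. c i) \<le> (\<Prod>i < card S. c i)"
  using assms(1)
proof (induction "card S" arbitrary: S)
  case 0
  then have "S = {}" using finite_subset[of S "{..<n}"] by simp
  then show ?case by simp
next
  case (Suc k S)
  have fin: "finite S" using Suc.prems finite_subset by blast
  have "S \<noteq> {}" using Suc.hyps(2) by auto
  define m where "m = Max S"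
  have m: "m \<in> S" "S \<subseteq> {..m}" using fin \<open>S \<noteq> {}\<close> by (auto simp: m_def)
  have "Suc k \<le> Suc m" using card_mono[OF _ m(2)] Suc.hyps(2) by simp
  have "m < n" using m Suc.prems by auto
  have cS: "card (S - {m}) = k" using m fin Suc.hyps(2) by simp
  have "(\<Prod>i \<in> S. c i) = (\<Prod>i \<in> S - {m}. c i) * c m"
    using m fin by (simp add: prod.remove mult.commute)
  also have "\<dots> \<le> (\<Prod>i < k. c i) * c k"
  proof (rule mult_mono)
    show "(\<Prod>i \<in> S - {m}. c i) \<le> (\<Prod>i < k. c i)"
      using Suc.hyps(1)[of "S - {m}"] Suc.prems cS by auto
    show "c m \<le> c k" using assms(3)[of k m] \<open>Suc k \<le> Suc m\<close> \<open>m < n\<close> by simp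
    show "0 \<le> (\<Prod>i < k. c i)"
      using \<open>Suc k \<le> Suc m\<close> \<open>m < n\<close> by (intro prod_nonneg assms(2)) auto
    show "0 \<le> c m" using assms(2) \<open>m < n\<close> by simp
  qed
  finally show ?case by (simp flip: Suc.hyps(2))
qed

text \<open>After the change of variables \<open>Y = V* Z\<close> the matrix \<open>H\<close> becomes diagonal and each squared minor of
\<open>Y\<close> is weighted by a product of \<open>k\<close> distinct eigenvalues, which is at most the product of the
\<open>k\<close> largest ones.\<close>
lemma det_compression_le:
  assumes V: "unitary_mat n V" and Z: "Z \<in> carrier_mat n k"
    and c: "\<And>i. i < n \<Longrightarrow> 0 \<le> c i" "\<And>i j. i \<le> j \<Longrightarrow> j < n \<Longrightarrow> c j \<le> c i"
    and H: "H = V * mat_diag n (\<lambda>i. complex_of_real (c i)) * mat_adjoint V"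
  shows "Re (det (mat_adjoint Z * (H * Z))) \<le> (\<Prod>i < k. c i) * Re (det (mat_adjoint Z * Z))"
proof -
  note [simp] = unitary_matD(1,2)[OF V]
  let ?D = "mat_diag n (\<lambda>i. complex_of_real (c i))"
  define Y where "Y = mat_adjoint V * Z"
  have Y: "Y \<in> carrier_mat n k" using Z by (simp add: Y_def mult_carrier_mat[of _ n n])
  have Z_eq: "Z = V * Y" using Z by (simp add: Y_def unitary_cancel[OF V, where m = k])
  have ZZ: "mat_adjoint Z * Z = mat_adjoint Y * Y"
    using Y unfolding Z_eq
    by (simp add: mat_adjoint_mult[of _ n n _ k] assoc_mult_mat[of _ k n _ n _ k]
        unitary_cancel[OF V, where m = k] mult_carrier_mat[of _ n n])
  have HZ: "H * Z = V * (?D * Y)"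
    using Y unfolding Z_eq H
    by (simp add: assoc_mult_mat[of _ n n _ n _ k] assoc_mult_mat[of _ n n _ n _ n]
        unitary_cancel[OF V, where m = k] mult_carrier_mat[of _ n n])
  have ZHZ: "mat_adjoint Z * (H * Z) = mat_adjoint Y * (?D * Y)"
    using Y unfolding HZ unfolding Z_eq
    by (simp add: mat_adjoint_mult[of _ n n _ k] assoc_mult_mat[of _ k n _ n _ k]
        unitary_cancel[OF V, where m = k] mult_carrier_mat[of _ n n])
  have DY: "?D * Y \<in> carrier_mat n k" using Y by (simp add: mult_carrier_mat[of _ n n])
  let ?y = "\<lambda>f. (cmod (det (rows_of k Y f)))\<^sup>2"
  have det_DY: "det (rows_of k (?D * Y) f) = complex_of_real (\<Prod>i<k. c (f i)) * det (rows_of k Y f)"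
    if f: "f \<in> row_choices k n" for f
  proof -
    have "rows_of k (?D * Y) f = mat\<^sub>r k k (\<lambda>i. complex_of_real (c (f i)) \<cdot>\<^sub>v row (rows_of k Y f) i)"
      using f Y by (intro eq_matI) (auto simp: rows_of_def mat_diag_mult_left[OF Y] row_choices_def)
    also have "det \<dots> = (\<Prod>i \<in> {0..<k}. complex_of_real (c (f i))) * det (mat\<^sub>r k k (row (rows_of k Y f)))"
      by (rule det_rows_mul) (auto simp: rows_of_def)
    also have "mat\<^sub>r k k (row (rows_of k Y f)) = rows_of k Y f"
      by (intro eq_matI) (auto simp: rows_of_def)
    finally show ?thesis by (simp add: atLeast0LessThan)
  qed
  have le: "(\<Prod>i<k. c (f i)) * ?y f \<le> (\<Prod>i<k. c i) * ?y f" if f: "f \<in> row_choices k n" for f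
  proof (cases "inj_on f {..<k}")
    case True
    have "(\<Prod>i<k. c (f i)) = (\<Prod>i \<in> f ` {..<k}. c i)"
      by (simp add: prod.reindex[OF True])
    also have "\<dots> \<le> (\<Prod>i < card (f ` {..<k}). c i)"
      by (rule prod_antimono_le[OF _ c]) (use f in \<open>auto simp: row_choices_def\<close>)
    finally show ?thesis by (intro mult_right_mono) (simp_all add: card_image[OF True])
  next
    case False
    then obtain i j where ij: "i < k" "j < k" "i \<noteq> j" "f i = f j" by (auto simp: inj_on_def)
    have "det (rows_of k Y f) = 0"
      by (rule det_identical_rows[OF rows_of_carrier ij(3,1,2)])
         (use ij in \<open>auto simp: rows_of_def\<close>)
    then show ?thesis by simp
  qed
  have "fact k * det (mat_adjoint Z * (H * Z)) =
      complex_of_real (\<Sum>f \<in> row_choices k n. (\<Prod>i<k. c (f i)) * ?y f)"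
    unfolding ZHZ det_adjoint_mult[OF Y DY] of_real_sum
    by (intro sum.cong) (simp_all add: det_DY complex_norm_square mult_ac del: of_real_power)
  then have "complex_of_real (fact k) * det (mat_adjoint Z * (H * Z)) =
      complex_of_real (\<Sum>f \<in> row_choices k n. (\<Prod>i<k. c (f i)) * ?y f)" by simp
  from arg_cong[OF this, of Re]
  have "fact k * Re (det (mat_adjoint Z * (H * Z))) = (\<Sum>f \<in> row_choices k n. (\<Prod>i<k. c (f i)) * ?y f)"
    by (simp del: of_real_fact of_real_sum)
  also have "\<dots> \<le> (\<Prod>i<k. c i) * (\<Sum>f \<in> row_choices k n. ?y f)"
    unfolding sum_distrib_left by (intro sum_mono le)
  finally show ?thesis
    unfolding ZZ det_gram[OF Y] Re_complex_of_real by (simp add: field_simps)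
qed

section \<open>Singular values of products\<close>

definition decreasing_below :: "nat \<Rightarrow> (nat \<Rightarrow> real) \<Rightarrow> bool" where
  "decreasing_below n d \<longleftrightarrow> (\<forall>i j. i \<le> j \<longrightarrow> j < n \<longrightarrow> d j \<le> d i)"

lemma psd_diagonalizationD:
  assumes "psd_diagonalization A U d" "A \<in> carrier_mat n n"
  shows "unitary_mat n U" "\<And>i. i < n \<Longrightarrow> 0 \<le> d i"
    "A = U * mat_diag n (\<lambda>i. complex_of_real (d i)) * mat_adjoint U"
  using assms by (auto simp: psd_diagonalization_def)

text \<open>The eigenvalues of \<open>M* M\<close> are nonnegative because they are the squared norms of the columns of \<open>M U\<close>.\<close>
lemma adjoint_mult_self_diagonalization:
  assumes M: "M \<in> carrier_mat n n"
  shows "\<exists>U d. psd_diagonalization (mat_adjoint M * M) U d"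
proof -
  let ?H = "mat_adjoint M * M"
  have M' [simp]: "M \<in> carrier_mat n n" "mat_adjoint M \<in> carrier_mat n n" using M by simp_all
  have "mat_adjoint ?H = ?H" by (simp add: mat_adjoint_mult[of _ n n _ n])
  then obtain U d where U: "unitary_mat n U"
    and H: "?H = U * mat_diag n (\<lambda>i. complex_of_real (d i)) * mat_adjoint U"
    using hermitian_diagonalization[of ?H n] by auto
  note [simp] = unitary_matD(1,2)[OF U]
  let ?D = "mat_diag n (\<lambda>i. complex_of_real (d i))"
  have "mat_adjoint (M * U) * (M * U) = mat_adjoint U * (?H * U)"
    by (simp add: mat_adjoint_mult[of _ n n _ n] assoc_mult_mat[of _ n n _ n _ n])
  also have "\<dots> = ?D"
    unfolding H using unitary_matD(3)[OF U]
    by (simp add: assoc_mult_mat[of _ n n _ n _ n] unitary_cancel[OF U, where m = n]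
        right_mult_one_mat[of _ n n])
  finally have D: "mat_adjoint (M * U) * (M * U) = ?D" .
  have "0 \<le> d i" if i: "i < n" for i
  proof -
    have "complex_of_real (d i) = complex_of_real (\<Sum>l<n. (cmod ((M * U) $$ (l, i)))\<^sup>2)"
      using adjoint_mult_self_index[of "M * U" n n i] i D by (simp add: mat_diag_def)
    then have "d i = (\<Sum>l<n. (cmod ((M * U) $$ (l, i)))\<^sup>2)"
      by (simp only: of_real_eq_iff)
    then show ?thesis by (simp add: sum_nonneg)
  qed
  moreover have "dim_row ?H = n" using carrier_matD[OF M] by simp
  ultimately have "psd_diagonalization ?H U d"
    using U H unfolding psd_diagonalization_def by metis
  then show ?thesis by blast
qed

lemma diagonalization_index:
  assumes U: "U \<in> carrier_mat n n" and ij: "i < n" "j < n"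
  shows "(U * mat_diag n f * mat_adjoint U) $$ (i, j) = (\<Sum>l<n. U $$ (i, l) * f l * cnj (U $$ (j, l)))"
  using assms carrier_matD[OF U]
  by (simp add: mat_diag_mult_right[OF U] scalar_prod_def mat_adjoint_index[OF U] atLeast0LessThan)

text \<open>Sorting the eigenvalues permutes the columns of \<open>U\<close>, which only reorders the sum in
\<open>diagonalization_index\<close>.\<close>
lemma psd_diagonalization_decreasing:
  assumes d: "psd_diagonalization A U d" and A: "A \<in> carrier_mat n n"
  shows "\<exists>V e. psd_diagonalization A V e \<and> decreasing_below n e"
proof -
  note D = psd_diagonalizationD[OF d A]
  note U = unitary_matD(1)[OF D(1)]
  define xs where "xs = rev (sort_key d [0..<n])"
  define p where "p i = xs ! i" for i
  have xs: "length xs = n" "distinct xs" "set xs = {..<n}"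
    by (auto simp: xs_def)
  have p: "bij_betw p {..<n} {..<n}"
    unfolding p_def by (rule bij_betw_nth[OF xs(2)]) (simp_all add: xs(1,3))
  have pn: "p i < n" if "i < n" for i
    using bij_betwE[OF p] that by auto
  have "sorted (rev (map d xs))" by (simp add: xs_def rev_map)
  then have dec: "decreasing_below n (\<lambda>i. d (p i))"
    unfolding decreasing_below_def p_def
    using xs(1) by (auto simp: sorted_rev_iff_nth_mono)
  define V where "V = mat n n (\<lambda>(i, j). U $$ (i, p j))"
  have V: "V \<in> carrier_mat n n" by (simp add: V_def)
  have re: "V * mat_diag n (\<lambda>i. f (p i)) * mat_adjoint V = U * mat_diag n f * mat_adjoint U" for f
  proof (rule eq_matI)
    fix i j assume "i < dim_row (U * mat_diag n f * mat_adjoint U)"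
      "j < dim_col (U * mat_diag n f * mat_adjoint U)"
    then have ij: "i < n" "j < n" using carrier_matD[OF U] by simp_all
    have "(V * mat_diag n (\<lambda>i. f (p i)) * mat_adjoint V) $$ (i, j) =
        (\<Sum>l<n. U $$ (i, p l) * f (p l) * cnj (U $$ (j, p l)))"
      unfolding diagonalization_index[OF V ij] using ij by (intro sum.cong) (simp_all add: V_def)
    also have "\<dots> = (\<Sum>l<n. U $$ (i, l) * f l * cnj (U $$ (j, l)))"
      by (rule sum.reindex_bij_betw[OF p, of "\<lambda>l. U $$ (i, l) * f l * cnj (U $$ (j, l))"])
    finally show "(V * mat_diag n (\<lambda>i. f (p i)) * mat_adjoint V) $$ (i, j) =
        (U * mat_diag n f * mat_adjoint U) $$ (i, j)"
      unfolding diagonalization_index[OF U ij] .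
  qed (use carrier_matD[OF U] carrier_matD[OF V] in simp_all)
  have "V * mat_adjoint V = 1\<^sub>m n"
    using re[of "\<lambda>_. 1"] unitary_matD(4)[OF D(1)]
    by (simp add: right_mult_one_mat[OF U] right_mult_one_mat[OF V])
  then have "unitary_mat n V"
    using V mat_mult_left_right_inverse[OF V, of "mat_adjoint V"] by (simp add: unitary_mat_def)
  then have "psd_diagonalization A V (\<lambda>i. d (p i))"
    using re[of "\<lambda>i. complex_of_real (d i)"] D carrier_matD[OF A] pn
    by (simp add: psd_diagonalization_def)
  with dec show ?thesis by blast
qed

lemma decreasing_singular_values:
  assumes "M \<in> carrier_mat n n"
  obtains U d where "psd_diagonalization (mat_adjoint M * M) U d" "decreasing_below n d"
proof -
  have "mat_adjoint M * M \<in> carrier_mat n n" using assms by simp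
  then show thesis
    using adjoint_mult_self_diagonalization[OF assms] psd_diagonalization_decreasing that by blast
qed

lemma det_gram_nonneg:
  assumes "P \<in> carrier_mat n k"
  shows "0 \<le> Re (det (mat_adjoint P * P))"
    "det (mat_adjoint P * P) = complex_of_real (Re (det (mat_adjoint P * P)))"
  unfolding det_gram[OF assms] Re_complex_of_real
  by (intro divide_nonneg_pos sum_nonneg) (simp_all del: of_real_sum of_real_divide)

lemma det_adjoint_mult_self_compression_le:
  assumes M: "M \<in> carrier_mat n n" and Z: "Z \<in> carrier_mat n k"
    and d: "psd_diagonalization (mat_adjoint M * M) U d" "decreasing_below n d"
  shows "Re (det (mat_adjoint (M * Z) * (M * Z))) \<le> (\<Prod>i<k. d i) * Re (det (mat_adjoint Z * Z))"
proof -
  have M' [simp]: "M \<in> carrier_mat n n" "mat_adjoint M \<in> carrier_mat n n" "mat_adjoint Z \<in> carrier_mat k n"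
    "Z \<in> carrier_mat n k" "M * Z \<in> carrier_mat n k"
    using M Z by (simp_all add: mult_carrier_mat[of _ n n])
  note D = psd_diagonalizationD[OF d(1), of n, simplified]
  have "mat_adjoint (M * Z) * (M * Z) = mat_adjoint Z * ((mat_adjoint M * M) * Z)"
    by (simp add: mat_adjoint_mult[of _ n n _ k] assoc_mult_mat[of _ k n _ n _ k]
        assoc_mult_mat[of _ n n _ n _ k])
  then show ?thesis
    using det_compression_le[OF D(1) Z D(2) _ D(3)] d(2) by (auto simp: decreasing_below_def)
qed

text \<open>Here \<open>a\<close>, \<open>b\<close>, \<open>c\<close> are the squared singular values of \<open>C Y D\<close>, \<open>C^2 Y\<close> and \<open>Y D^2\<close>. For \<open>k = 1\<close> the
argument is that \<open>(C Y D)* (C Y D) = D Y* C^2 Y D\<close> has the same eigenvalues as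
\<open>D^2 Y* C^2 Y = (Y D^2)* (C^2 Y)\<close>, and the spectral radius of the latter is at most the product of
the norms of the two factors. For general \<open>k\<close>, let the columns of \<open>E\<close> be eigenvectors of the first
matrix for \<open>a 0, ..., a (k - 1)\<close>; the columns of \<open>Z = D E\<close> span an invariant subspace of the second
one. With \<open>P = Y D^2 Z\<close> and \<open>R = C^2 Y Z\<close>, comparing \<open>P* R = (Z* Z) diag(a)\<close> with the Cauchy-Schwarz
inequality for determinants gives the claim, as \<open>det (P* P)\<close> and \<open>det (R* R)\<close> are at most
\<open>det (Z* Z)\<close> times the products of the \<open>c i\<close> and the \<open>b i\<close>.\<close>
theorem singular_value_log_majorization:
  assumes C: "C \<in> carrier_mat n n" "mat_adjoint C = C"
    and D: "D \<in> carrier_mat n n" "mat_adjoint D = D"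
    and D': "D' \<in> carrier_mat n n" "D' * D = 1\<^sub>m n"
    and Y: "Y \<in> carrier_mat n n"
    and a: "psd_diagonalization (mat_adjoint (C * Y * D) * (C * Y * D)) U a"
    and b: "psd_diagonalization (mat_adjoint (C * C * Y) * (C * C * Y)) V b" "decreasing_below n b"
    and c: "psd_diagonalization (mat_adjoint (Y * (D * D)) * (Y * (D * D))) W c" "decreasing_below n c"
    and k: "k \<le> n"
  shows "(\<Prod>i<k. a i)\<^sup>2 \<le> (\<Prod>i<k. b i) * (\<Prod>i<k. c i)"
proof -
  note [simp] = C(1) D(1) D'(1) Y
  have H [simp]: "mat_adjoint (C * Y * D) * (C * Y * D) \<in> carrier_mat n n"
    by (simp add: mat_adjoint_carrier[of _ n n])
  note A = psd_diagonalizationD[OF a H]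
  note U [simp] = unitary_matD(1,2)[OF A(1)]
  let ?H = "mat_adjoint (C * Y * D) * (C * Y * D)"
  define E where "E = mat n k (\<lambda>(i, j). U $$ (i, j))"
  have E [simp]: "E \<in> carrier_mat n k" "mat_adjoint E \<in> carrier_mat k n" by (simp_all add: E_def)
  have EE: "mat_adjoint E * E = 1\<^sub>m k"
  proof (rule eq_matI)
    fix i j assume "i < dim_row (1\<^sub>m k)" "j < dim_col (1\<^sub>m k)"
    then have ij: "i < k" "j < k" by simp_all
    have "(mat_adjoint E * E) $$ (i, j) = (mat_adjoint U * U) $$ (i, j)"
      using ij k carrier_matD[OF U(1)]
      by (simp add: scalar_prod_def mat_adjoint_index[OF E(1)] mat_adjoint_index[OF U(1)]
          carrier_matD[OF E(1)]) (simp add: E_def)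
    then show "(mat_adjoint E * E) $$ (i, j) = 1\<^sub>m k $$ (i, j)"
      using ij k by (simp add: unitary_matD(3)[OF A(1)])
  qed (simp_all add: E_def)
  let ?\<Delta> = "mat_diag k (\<lambda>i. complex_of_real (a i))"
  have "?H * U = U * mat_diag n (\<lambda>i. complex_of_real (a i))"
    by (subst A(3)) (simp add: assoc_mult_mat[of _ n n _ n _ n] unitary_matD(3)[OF A(1)]
        right_mult_one_mat[of _ n n])
  moreover have "(?H * E) $$ (i, j) = (?H * U) $$ (i, j)" if "i < n" "j < k" for i j
  proof -
    have "col E j = col U j" using that k by (intro eq_vecI) (auto simp: E_def carrier_matD[OF U(1)])
    then show ?thesis
      using that k carrier_matD[OF H] carrier_matD[OF U(1)] carrier_matD[OF E(1)] by (simp del: index_mult_mat(2,3) add: index_mult_mat(1))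
  qed
  ultimately have HE: "?H * E = E * ?\<Delta>"
    using k by (intro eq_matI) (auto simp: mat_diag_mult_right[OF E(1)] mat_diag_mult_right[OF U(1)]
        carrier_matD[OF E(1)] carrier_matD[OF D(1)] simp del: index_mult_mat(1), simp add: E_def)
  define Z where "Z = D * E"
  have Z [simp]: "Z \<in> carrier_mat n k" "mat_adjoint Z \<in> carrier_mat k n"
    by (simp_all add: Z_def mult_carrier_mat[of _ n n])
  let ?P = "Y * (D * D) * Z" and ?R = "C * C * Y * Z"
  have P: "?P \<in> carrier_mat n k" "?R \<in> carrier_mat n k" by (simp_all add: mult_carrier_mat[of _ n n])
  have "mat_adjoint ?P * ?R = mat_adjoint Z * (D * (?H * E))"
    unfolding Z_def
    by (simp add: mat_adjoint_mult[of _ n n _ n] mat_adjoint_mult[of _ n n _ k] C(2) D(2)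
        assoc_mult_mat[of _ n n _ n _ n] assoc_mult_mat[of _ n n _ n _ k] assoc_mult_mat[of _ k n _ n _ k]
        assoc_mult_mat[of _ k n _ n _ n] mult_carrier_mat[of _ n n] mult_carrier_mat[of _ k n])
  also have "\<dots> = mat_adjoint Z * Z * ?\<Delta>"
    unfolding HE Z_def
    by (simp add: assoc_mult_mat[of _ n n _ k _ k] assoc_mult_mat[of _ k n _ k _ k] mult_carrier_mat[of _ n n]
       mult_carrier_mat[of _ k n])
  finally have PR: "mat_adjoint ?P * ?R = mat_adjoint Z * Z * ?\<Delta>" .
  define \<gamma> where "\<gamma> = Re (det (mat_adjoint Z * Z))"
  have \<gamma>: "det (mat_adjoint Z * Z) = complex_of_real \<gamma>" "0 \<le> \<gamma>"
    using det_gram_nonneg[OF Z(1)] by (simp_all add: \<gamma>_def)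
  have "det ?\<Delta> = complex_of_real (\<Prod>i<k. a i)"
    by (subst det_upper_triangular[of _ k])
      (auto simp: mat_diag_def prod_list_diag_prod upper_triangular_def atLeast0LessThan)
  then have det_PR: "det (mat_adjoint ?P * ?R) = complex_of_real (\<gamma> * (\<Prod>i<k. a i))"
    unfolding PR by (subst det_mult[of _ k]) (simp_all add: \<gamma> mult_carrier_mat[of _ k n])
  \<comment> \<open>The Gram determinant of \<open>Z\<close> may be cancelled because \<open>D' Z = E\<close> has Gram determinant 1.\<close>
  obtain V' d where d: "psd_diagonalization (mat_adjoint D' * D') V' d" "decreasing_below n d"
    using decreasing_singular_values[OF D'(1)] by blast
  have "D' * Z = E"
    unfolding Z_def using D'(2) by (simp flip: assoc_mult_mat[of _ n n _ n _ k] add: left_mult_one_mat[of _ n k])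
  then have "1 \<le> (\<Prod>i<k. d i) * \<gamma>"
    using det_adjoint_mult_self_compression_le[OF D'(1) Z(1) d] by (simp add: EE \<gamma>_def)
  then have \<gamma>_pos: "0 < \<gamma>" using \<gamma>(2) by (cases "\<gamma> = 0") auto
  have "(\<gamma> * (\<Prod>i<k. a i))\<^sup>2 \<le> Re (det (mat_adjoint ?P * ?P)) * Re (det (mat_adjoint ?R * ?R))"
    using det_adjoint_mult_Cauchy_Schwarz[OF P] unfolding det_PR by (simp del: of_real_prod of_real_mult)
  also have "\<dots> \<le> ((\<Prod>i<k. c i) * \<gamma>) * ((\<Prod>i<k. b i) * \<gamma>)"
  proof (intro mult_mono)
    show "Re (det (mat_adjoint ?P * ?P)) \<le> (\<Prod>i<k. c i) * \<gamma>"
      unfolding \<gamma>_def by (rule det_adjoint_mult_self_compression_le[OF _ Z(1) c]) simp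
    then show "0 \<le> (\<Prod>i<k. c i) * \<gamma>" using det_gram_nonneg(1)[OF P(1)] by linarith
    show "Re (det (mat_adjoint ?R * ?R)) \<le> (\<Prod>i<k. b i) * \<gamma>"
      unfolding \<gamma>_def by (rule det_adjoint_mult_self_compression_le[OF _ Z(1) b]) simp
    show "0 \<le> Re (det (mat_adjoint ?R * ?R))" by (rule det_gram_nonneg(1)[OF P(2)])
  qed
  finally have "\<gamma>\<^sup>2 * (\<Prod>i<k. a i)\<^sup>2 \<le> \<gamma>\<^sup>2 * ((\<Prod>i<k. b i) * (\<Prod>i<k. c i))"
    by (simp add: power2_eq_square mult_ac)
  then show ?thesis using \<gamma>_pos by simp
qed

section \<open>Symmetric gauge functions and log-majorization\<close>

text \<open>The symmetric gauge function that a unitarily invariant norm \<open>N\<close> induces on real vectors of length \<open>n\<close>.\<close>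
definition diagonal_gauge :: "nat \<Rightarrow> (complex mat \<Rightarrow> real) \<Rightarrow> (nat \<Rightarrow> real) \<Rightarrow> real" where
  "diagonal_gauge n N x = N (mat_diag n (\<lambda>i. complex_of_real (x i)))"

context
  fixes n :: nat and N :: "complex mat \<Rightarrow> real"
  assumes N: "unitarily_invariant_norm n N"
begin

lemma gauge_cong:
  assumes "\<And>i. i < n \<Longrightarrow> x i = y i"
  shows "diagonal_gauge n N x = diagonal_gauge n N y"
proof -
  have "mat_diag n (\<lambda>i. complex_of_real (x i)) = mat_diag n (\<lambda>i. complex_of_real (y i))"
    using assms by (intro eq_matI) (auto simp: mat_diag_def)
  then show ?thesis by (simp add: diagonal_gauge_def)
qed

lemma gauge_nonneg: "0 \<le> diagonal_gauge n N x"
  using N by (simp add: diagonal_gauge_def unitarily_invariant_norm_def)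

lemma gauge_unitary:
  "unitary_mat n U \<Longrightarrow> unitary_mat n V \<Longrightarrow> M \<in> carrier_mat n n \<Longrightarrow> N (U * M * V) = N M"
  using N by (simp add: unitarily_invariant_norm_def)

lemma gauge_add: "diagonal_gauge n N (\<lambda>i. x i + y i) \<le> diagonal_gauge n N x + diagonal_gauge n N y"
proof -
  have "mat_diag n (\<lambda>i. complex_of_real (x i + y i)) =
      mat_diag n (\<lambda>i. complex_of_real (x i)) + mat_diag n (\<lambda>i. complex_of_real (y i))"
    by (intro eq_matI) (auto simp: mat_diag_def)
  then show ?thesis
    using N by (simp add: diagonal_gauge_def unitarily_invariant_norm_def)
qed

lemma gauge_scale: "diagonal_gauge n N (\<lambda>i. c * x i) = \<bar>c\<bar> * diagonal_gauge n N x"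
proof -
  have "mat_diag n (\<lambda>i. complex_of_real (c * x i)) =
      complex_of_real c \<cdot>\<^sub>m mat_diag n (\<lambda>i. complex_of_real (x i))"
    by (intro eq_matI) (auto simp: mat_diag_def)
  then show ?thesis
    using N by (simp add: diagonal_gauge_def unitarily_invariant_norm_def)
qed

lemma gauge_convex:
  assumes "0 \<le> s" "0 \<le> t"
  shows "diagonal_gauge n N (\<lambda>i. s * x i + t * y i) \<le> s * diagonal_gauge n N x + t * diagonal_gauge n N y"
  using gauge_add[of "\<lambda>i. s * x i" "\<lambda>i. t * y i"] assms by (simp add: gauge_scale)

lemma gauge_eq_0_iff: "diagonal_gauge n N x = 0 \<longleftrightarrow> (\<forall>i<n. x i = 0)"
proof -
  have "diagonal_gauge n N x = 0 \<longleftrightarrow> mat_diag n (\<lambda>i. complex_of_real (x i)) = 0\<^sub>m n n"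
    using N by (simp add: diagonal_gauge_def unitarily_invariant_norm_def)
  also have "\<dots> \<longleftrightarrow> (\<forall>i<n. x i = 0)"
    by (auto simp: mat_diag_def mat_eq_iff)
  finally show ?thesis .
qed

lemma gauge_permute:
  assumes p: "p permutes {..<n}"
  shows "diagonal_gauge n N (\<lambda>i. x (p i)) = diagonal_gauge n N x"
proof -
  define P where "P = mat n n (\<lambda>(i, j). if j = p i then 1 else 0 :: complex)"
  have P [simp]: "P \<in> carrier_mat n n" by (simp add: P_def)
  have pn: "p i < n" if "i < n" for i using permutes_in_image[OF p, of i] that by simp
  have conj: "P * mat_diag n f * mat_adjoint P = mat_diag n (\<lambda>i. f (p i))" for f
  proof (rule eq_matI)
    fix i j assume "i < dim_row (mat_diag n (\<lambda>i. f (p i)))" "j < dim_col (mat_diag n (\<lambda>i. f (p i)))"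
    then have ij: "i < n" "j < n" by (simp_all add: mat_diag_def)
    have "(P * mat_diag n f * mat_adjoint P) $$ (i, j) =
        (\<Sum>l<n. if l = p i then if p i = p j then f (p i) else 0 else 0)"
      unfolding diagonalization_index[OF P ij] using ij by (intro sum.cong) (auto simp: P_def)
    also have "\<dots> = (if i = j then f (p i) else 0)"
      using pn[OF ij(1)] by (simp add: sum.delta inj_eq[OF permutes_inj[OF p]])
    finally show "(P * mat_diag n f * mat_adjoint P) $$ (i, j) = mat_diag n (\<lambda>i. f (p i)) $$ (i, j)"
      using ij by (simp add: mat_diag_def)
  qed (simp_all add: mat_diag_def P_def)
  have "P * mat_adjoint P = 1\<^sub>m n"
    using conj[of "\<lambda>_. 1"] by (simp add: right_mult_one_mat[OF P])
  then have U: "unitary_mat n P"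
    using mat_mult_left_right_inverse[OF P, of "mat_adjoint P"] by (simp add: unitary_mat_def)
  show ?thesis
    using gauge_unitary[OF U unitary_mat_adjoint[OF U], of "mat_diag n (\<lambda>i. complex_of_real (x i))"]
    by (simp add: diagonal_gauge_def conj)
qed

lemma gauge_flip_sign:
  assumes "k < n"
  shows "diagonal_gauge n N (x(k := - x k)) = diagonal_gauge n N x"
proof -
  define S where "S = mat_diag n (\<lambda>i. complex_of_real (if i = k then - 1 else 1))"
  have S: "unitary_mat n S"
  proof (rule unitary_matI)
    have "mat_adjoint S * S = mat_diag n (\<lambda>i. 1)"
      unfolding S_def mat_adjoint_diag_real mat_diag_diag
      by (rule arg_cong[of _ _ "mat_diag n"]) (auto simp: fun_eq_iff)
    then show "mat_adjoint S * S = 1\<^sub>m n" by simp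
  qed (simp add: S_def)
  have "1\<^sub>m n * mat_diag n (\<lambda>i. complex_of_real (x i)) * S = mat_diag n (\<lambda>i. complex_of_real ((x(k := - x k)) i))"
    unfolding left_mult_one_mat[OF mat_diag_dim] S_def mat_diag_diag
    by (rule arg_cong[of _ _ "mat_diag n"]) (auto simp: fun_eq_iff)
  moreover have "unitary_mat n (1\<^sub>m n)" by (simp add: unitary_mat_def)
  ultimately show ?thesis
    using gauge_unitary[OF _ S, of "1\<^sub>m n" "mat_diag n (\<lambda>i. complex_of_real (x i))"]
    by (simp add: diagonal_gauge_def)
qed

text \<open>Scaling one coordinate by \<open>s\<close> in \<open>[0, 1]\<close> is a convex combination of keeping it and flipping its sign.\<close>
lemma gauge_shrink:
  assumes k: "k < n" and s: "0 \<le> s" "s \<le> 1"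
  shows "diagonal_gauge n N (x(k := s * x k)) \<le> diagonal_gauge n N x"
proof -
  have "x(k := s * x k) = (\<lambda>i. (1 + s) / 2 * x i + (1 - s) / 2 * (x(k := - x k)) i)"
    by (auto simp: fun_eq_iff field_simps)
  then have "diagonal_gauge n N (x(k := s * x k)) \<le>
      (1 + s) / 2 * diagonal_gauge n N x + (1 - s) / 2 * diagonal_gauge n N (x(k := - x k))"
    using gauge_convex[of "(1 + s) / 2" "(1 - s) / 2" x "x(k := - x k)"] s by simp
  also have "\<dots> = diagonal_gauge n N x"
    using gauge_flip_sign[OF k, of x] by (simp add: field_simps)
  finally show ?thesis .
qed

text \<open>Change the coordinates from \<open>y\<close> to \<open>x\<close> one at a time; each change only shrinks a coordinate.\<close>
lemma gauge_mono:
  assumes "\<And>i. i < n \<Longrightarrow> 0 \<le> x i" "\<And>i. i < n \<Longrightarrow> x i \<le> y i"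
  shows "diagonal_gauge n N x \<le> diagonal_gauge n N y"
proof -
  define z where "z m i = (if i < m then x i else y i)" for m i :: nat
  have "m \<le> n \<Longrightarrow> diagonal_gauge n N (z m) \<le> diagonal_gauge n N y" for m
  proof (induction m)
    case 0
    have "z 0 = y" by (simp add: z_def fun_eq_iff)
    then show ?case by simp
  next
    case (Suc m)
    then have m: "m < n" by simp
    have xy: "0 \<le> x m" "x m \<le> y m" using assms m by auto
    \<comment> \<open>If \<open>y m = 0\<close> then \<open>x m = 0\<close>, and the factor \<open>0 / 0 = 0\<close> is still right.\<close>
    then have "z (Suc m) = (z m)(m := x m / y m * z m m)"
      by (auto simp: z_def fun_eq_iff less_Suc_eq)
    moreover have "diagonal_gauge n N ((z m)(m := x m / y m * z m m)) \<le> diagonal_gauge n N (z m)"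
      using xy by (intro gauge_shrink m) (auto simp: divide_le_eq_1)
    ultimately show ?case using Suc.IH m by (metis less_imp_le order_trans)
  qed
  from this[of n] have "diagonal_gauge n N (z n) \<le> diagonal_gauge n N y" by simp
  also have "diagonal_gauge n N (z n) = diagonal_gauge n N x"
    by (rule gauge_cong) (simp add: z_def)
  finally show ?thesis .
qed

text \<open>Moving a factor \<open>c\<close> from the larger coordinate to the smaller one, without reversing their order, does
not increase the gauge: the sum of the two coordinates does not grow, so the new vector is dominated by a convex
combination of \<open>y\<close> and \<open>y\<close> with the two coordinates exchanged.\<close>
lemma gauge_transfer:
  assumes ik: "i < n" "k < n" "i \<noteq> k" and y: "\<And>j. j < n \<Longrightarrow> 0 \<le> y j"
    and c: "1 < c" "0 < y k" "c * y k \<le> y i / c"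
  shows "diagonal_gauge n N (y(i := y i / c, k := c * y k)) \<le> diagonal_gauge n N y"
proof -
  define a b where "a = y i" and "b = y k"
  have b: "0 < b" "c * b \<le> a / c" using c by (simp_all add: a_def b_def)
  have "b < c * b" using c(1) b(1) by simp
  then have bc: "b < a / c" using b(2) by (rule order_less_le_trans)
  have "0 < a / c" using b(1) bc by linarith
  then have a0: "0 < a" using c(1) by (simp add: zero_less_divide_iff)
  have ca: "a / c < a" using c(1) a0 by (simp add: divide_less_eq)
  \<comment> \<open>The weight for which the convex combination has the value \<open>a / c\<close> at \<open>i\<close>.\<close>
  define s where "s = (a / c - b) / (a - b)"
  have s: "0 \<le> s" "s \<le> 1" using bc ca by (auto simp: s_def divide_le_eq_1)
  have s_ab: "s * (a - b) = a / c - b" using bc ca by (simp add: s_def)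
  define q where "q = transpose i k"
  have q: "q permutes {..<n}" unfolding q_def by (rule permutes_swap_id) (use ik in auto)
  have at_i: "s * a + (1 - s) * b = a / c" using s_ab by (simp add: algebra_simps)
  have at_k: "s * b + (1 - s) * a = a + b - a / c" using s_ab by (simp add: algebra_simps)
  have "c * b * (c - 1) \<le> a / c * (c - 1)" using b c by (intro mult_right_mono) auto
  then have "c * b \<le> a + b - a / c"
  proof -
    have "b * (c - 1) \<le> c * b * (c - 1) / c" using c by simp
    also have "\<dots> \<le> a / c * (c - 1) / c"
      using \<open>c * b * (c - 1) \<le> _\<close> c by (intro divide_right_mono) auto
    also have "\<dots> \<le> a / c * (c - 1)"
      using c a0 by (simp add: divide_le_eq)
    also have "\<dots> = a - a / c" using c by (simp add: field_simps)
    finally show ?thesis by (simp add: algebra_simps)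
  qed
  have "diagonal_gauge n N (y(i := y i / c, k := c * y k)) \<le>
      diagonal_gauge n N (\<lambda>j. s * y j + (1 - s) * y (q j))"
  proof (rule gauge_mono)
    fix j assume j: "j < n"
    show "0 \<le> (y(i := y i / c, k := c * y k)) j" using y[OF j] y[OF ik(1)] c by auto
    show "(y(i := y i / c, k := c * y k)) j \<le> s * y j + (1 - s) * y (q j)"
    proof (cases "j = k")
      case True
      then show ?thesis using at_k \<open>c * b \<le> a + b - a / c\<close> by (simp add: q_def a_def b_def)
    next
      case False
      then show ?thesis
        using at_i by (cases "j = i") (simp_all add: q_def a_def b_def algebra_simps)
    qed
  qed
  also have "\<dots> \<le> s * diagonal_gauge n N y + (1 - s) * diagonal_gauge n N (\<lambda>j. y (q j))"
    using s by (intro gauge_convex) auto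
  also have "\<dots> = diagonal_gauge n N y" by (simp add: gauge_permute[OF q] algebra_simps)
  finally show ?thesis .
qed

text \<open>Let \<open>k\<close> be the first index at which \<open>x\<close> exceeds \<open>y\<close>. Since the product up to \<open>k\<close> of \<open>x\<close> is not larger than
that of \<open>y\<close>, some earlier \<open>i\<close> has \<open>x i < y i\<close>. Transfer a factor \<open>c\<close> from \<open>y i\<close> to \<open>y k\<close>, as large as
possible subject to \<open>x i \<le> y i / c\<close> and \<open>c * y k \<le> x k\<close>. This makes \<open>y\<close> agree with \<open>x\<close> at
one more index. The products up to \<open>m > k\<close> are unchanged, and below \<open>k\<close> the new vector still
dominates \<open>x\<close> pointwise, so the hypotheses are preserved.\<close>
theorem gauge_le_if_log_majorized:
  assumes x: "\<And>i. i < n \<Longrightarrow> 0 \<le> x i" "decreasing_below n x"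
    and "\<And>i. i < n \<Longrightarrow> 0 \<le> y i"
    and "\<And>m. m \<le> n \<Longrightarrow> (\<Prod>j<m. x j) \<le> (\<Prod>j<m. y j)"
  shows "diagonal_gauge n N x \<le> diagonal_gauge n N y"
  using assms(3,4)
proof (induction "card {i. i < n \<and> x i \<noteq> y i}" arbitrary: y rule: less_induct)
  case (less y)
  show ?case
  proof (cases "\<forall>i<n. x i \<le> y i")
    case True
    then show ?thesis using x(1) by (intro gauge_mono) auto
  next
    case False
    define k where "k = (LEAST k. k < n \<and> y k < x k)"
    have k: "k < n" "y k < x k" using LeastI_ex[of "\<lambda>k. k < n \<and> y k < x k"] False
      by (auto simp: k_def not_le)
    have before: "x j \<le> y j" if "j < k" for j
      using not_less_Least[of j "\<lambda>k. k < n \<and> y k < x k"] that k(1) by (auto simp: k_def)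
    have xk: "0 < x k" using k less.prems(1)[of k] by simp
    have xpos: "0 < x j" if "j \<le> k" for j
      using x(2) that k(1) xk by (force simp: decreasing_below_def)
    have px: "0 < (\<Prod>j<Suc k. x j)" using xpos by (intro prod_pos) auto
    have pxy: "(\<Prod>j<Suc k. x j) \<le> (\<Prod>j<Suc k. y j)" using k less.prems(2)[of "Suc k"] by simp
    then have "(\<Prod>j<Suc k. y j) \<noteq> 0" using px by linarith
    then have yk: "0 < y k" using less.prems(1)[OF k(1)] by (auto simp: order_le_less)
    have "\<exists>i<k. x i < y i"
    proof (rule ccontr)
      assume "\<not> (\<exists>i<k. x i < y i)"
      then have "(\<Prod>j<k. x j) = (\<Prod>j<k. y j)" using before
        by (intro prod.cong refl) (meson antisym lessThan_iff not_less)
      moreover have "0 < (\<Prod>j<k. x j)" using xpos by (intro prod_pos) auto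
      ultimately show False using pxy k(2) by simp
    qed
    then obtain i where i: "i < k" "x i < y i" by blast
    define c where "c = min (y i / x i) (x k / y k)"
    have xi: "0 < x i" using xpos i by simp
    have c1: "1 < c" using i k xi yk by (simp add: c_def)
    have "c \<le> y i / x i" "c \<le> x k / y k" by (auto simp: c_def)
    then have ci: "x i \<le> y i / c" and ck: "c * y k \<le> x k"
      using xi yk c1 by (simp_all add: field_simps)
    have "x k \<le> x i" using x(2) i k by (simp add: decreasing_below_def)
    define y' where "y' = y(i := y i / c, k := c * y k)"
    have y': "y' i = y i / c" "y' k = c * y k" "\<And>j. j \<noteq> i \<Longrightarrow> j \<noteq> k \<Longrightarrow> y' j = y j"
      using i by (auto simp: y'_def)
    have "diagonal_gauge n N x \<le> diagonal_gauge n N y'"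
    proof (rule less.hyps)
      have "y' i = x i \<or> y' k = x k"
        using xi yk i by (auto simp: y' c_def min_def)
      then have "\<exists>j \<in> {j. j < n \<and> x j \<noteq> y j}. j \<notin> {j. j < n \<and> x j \<noteq> y' j}"
      proof
        assume "y' i = x i"
        then show ?thesis using i k by (intro bexI[of _ i]) auto
      next
        assume "y' k = x k"
        then show ?thesis using k by (intro bexI[of _ k]) auto
      qed
      moreover have "{j. j < n \<and> x j \<noteq> y' j} \<subseteq> {j. j < n \<and> x j \<noteq> y j}"
      proof clarify
        fix j assume "j < n" "x j \<noteq> y' j" "x j = y j"
        then show False using i k y'(3)[of j] by (cases "j = i"; cases "j = k") auto
      qed
      ultimately have "{j. j < n \<and> x j \<noteq> y' j} \<subset> {j. j < n \<and> x j \<noteq> y j}" by blast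
      then show "card {j. j < n \<and> x j \<noteq> y' j} < card {j. j < n \<and> x j \<noteq> y j}"
        by (intro psubset_card_mono) auto
      show "0 \<le> y' j" if "j < n" for j
        using less.prems(1)[OF that] c1 by (auto simp: y'_def less.prems(1))
      show "(\<Prod>j<m. x j) \<le> (\<Prod>j<m. y' j)" if m: "m \<le> n" for m
      proof (cases "m \<le> k")
        case True
        have "x j \<le> y' j" if "j < m" for j
          using before[of j] ci that True by (cases "j = i") (auto simp: y'_def)
        then show ?thesis using x(1) m by (intro prod_mono) auto
      next
        case False
        then have in_m: "i \<in> {..<m}" "k \<in> {..<m} - {i}" using i by auto
        have split: "(\<Prod>j<m. f j) = f i * (f k * (\<Prod>j \<in> {..<m} - {i} - {k}. f j))" for f :: "nat \<Rightarrow> real"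
          using in_m by (simp add: prod.remove[of "{..<m}" i] prod.remove[of "{..<m} - {i}" k])
        have "(\<Prod>j \<in> {..<m} - {i} - {k}. y' j) = (\<Prod>j \<in> {..<m} - {i} - {k}. y j)"
          by (intro prod.cong) (auto simp: y'(3))
        then have "(\<Prod>j<m. y' j) = (\<Prod>j<m. y j)"
          using c1 by (simp add: split y'(1,2))
        then show ?thesis using less.prems(2)[OF m] by simp
      qed
    qed
    also have "\<dots> \<le> diagonal_gauge n N y"
      unfolding y'_def
      by (rule gauge_transfer) (use i k c1 yk ci ck \<open>x k \<le> x i\<close> less.prems(1) in auto)
    finally show ?thesis .
  qed
qed

text \<open>By the inequality of arithmetic and geometric means the left-hand gauge is at most
\<open>(s g(x) + g(y) / s) / 2\<close> for every \<open>s > 0\<close>; the best \<open>s\<close> is \<open>sqrt (g(y) / g(x))\<close>.\<close>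
lemma gauge_sqrt_mult_le:
  assumes x: "\<And>i. i < n \<Longrightarrow> 0 \<le> x i" and y: "\<And>i. i < n \<Longrightarrow> 0 \<le> y i"
  shows "(diagonal_gauge n N (\<lambda>i. sqrt (x i * y i)))\<^sup>2 \<le> diagonal_gauge n N x * diagonal_gauge n N y"
proof (cases "diagonal_gauge n N x = 0 \<or> diagonal_gauge n N y = 0")
  case True
  then have "diagonal_gauge n N (\<lambda>i. sqrt (x i * y i)) = 0"
    unfolding gauge_eq_0_iff by auto
  then show ?thesis by (simp add: gauge_nonneg)
next
  case False
  define g h where "g = diagonal_gauge n N x" and "h = diagonal_gauge n N y"
  have gh: "0 < g" "0 < h" using False gauge_nonneg by (auto simp: g_def h_def order_less_le)
  define s where "s = sqrt (h / g)"
  have s: "0 < s" using gh by (simp add: s_def)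
  have "diagonal_gauge n N (\<lambda>i. sqrt (x i * y i)) \<le> diagonal_gauge n N (\<lambda>i. s / 2 * x i + 1 / (2 * s) * y i)"
  proof (rule gauge_mono)
    fix i assume i: "i < n"
    show "0 \<le> sqrt (x i * y i)" using x y i by simp
    have "sqrt (x i * y i) = sqrt ((s * x i) * (y i / s))" using s by simp
    also have "\<dots> \<le> (s * x i + y i / s) / 2"
      using s x[OF i] y[OF i] by (intro arith_geo_mean_sqrt) auto
    finally show "sqrt (x i * y i) \<le> s / 2 * x i + 1 / (2 * s) * y i" using s by (simp add: field_simps)
  qed
  also have "\<dots> \<le> s / 2 * g + 1 / (2 * s) * h"
    unfolding g_def h_def using s by (intro gauge_convex) auto
  also have "\<dots> = sqrt (g * h)"
  proof -
    have "s * g = sqrt (g * h)" "h / s = sqrt (g * h)"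
      using gh by (simp_all add: s_def real_sqrt_divide real_sqrt_mult field_simps)
    moreover have "s / 2 * g + 1 / (2 * s) * h = (s * g + h / s) / 2" using s by (simp add: field_simps)
    ultimately show ?thesis by simp
  qed
  finally have "(diagonal_gauge n N (\<lambda>i. sqrt (x i * y i)))\<^sup>2 \<le> (sqrt (g * h))\<^sup>2"
    by (intro power_mono gauge_nonneg)
  then show ?thesis using gh by (simp add: g_def h_def)
qed

end

section \<open>Real powers of a positive definite matrix\<close>

text \<open>The eigenvalue \<open>d i\<close> is the value of the quadratic form of \<open>A\<close> at the \<open>i\<close>-th column of \<open>U\<close>.\<close>
lemma positive_definite_diagonalization:
  assumes "positive_definite_mat n A"
  shows "\<exists>U d. psd_diagonalization A U d \<and> (\<forall>i<n. 0 < d i)"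
proof -
  have A [simp]: "A \<in> carrier_mat n n" and "mat_adjoint A = A"
    and pos: "\<And>v. v \<in> carrier_vec n \<Longrightarrow> v \<noteq> 0\<^sub>v n \<Longrightarrow> 0 < Re ((A *\<^sub>v v) \<bullet>c v)"
    using assms by (auto simp: positive_definite_mat_def)
  then obtain U d where U: "unitary_mat n U"
    and A_eq: "A = U * mat_diag n (\<lambda>i. complex_of_real (d i)) * mat_adjoint U"
    using hermitian_diagonalization by blast
  note Uc [simp] = unitary_matD(1,2)[OF U]
  let ?D = "mat_diag n (\<lambda>i. complex_of_real (d i))"
  have D: "mat_adjoint U * (A * U) = ?D"
    unfolding A_eq by (simp add: assoc_mult_mat[of _ n n _ n _ n] unitary_cancel[OF U, where m = n]
        unitary_matD(3)[OF U] right_mult_one_mat[of _ n n])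
  have dpos: "0 < d i" if i: "i < n" for i
  proof -
    let ?v = "col U i"
    have v: "?v \<in> carrier_vec n" using carrier_matD[OF Uc(1)] by (auto intro!: carrier_vecI)
    have row: "row (mat_adjoint U) i = conjugate ?v"
      using i carrier_matD[OF Uc(1)] by (intro eq_vecI) (simp_all add: mat_adjoint_index[OF Uc(1)])
    have ip: "(A *\<^sub>v ?v) \<bullet>c ?v = complex_of_real (d i)"
    proof -
      have "(A *\<^sub>v ?v) \<bullet>c ?v = conjugate ?v \<bullet> (A *\<^sub>v ?v)"
        using v by (intro comm_scalar_prod[of _ n]) (auto intro!: mult_mat_vec_carrier[of _ n n])
      also have "\<dots> = (mat_adjoint U * (A * U)) $$ (i, i)"
        using i carrier_matD[OF Uc(1)] carrier_matD[OF A]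
        by (simp add: row col_mult2[OF A Uc(1)])
      also have "\<dots> = complex_of_real (d i)" using i by (simp add: D mat_diag_def)
      finally show ?thesis .
    qed
    have "?v \<noteq> 0\<^sub>v n"
    proof
      assume 0: "?v = 0\<^sub>v n"
      have "(mat_adjoint U * U) $$ (i, i) = row (mat_adjoint U) i \<bullet> ?v"
        using i carrier_matD[OF Uc(1)] by simp
      also have "\<dots> = 0" using i carrier_matD[OF Uc(1)] by (simp add: 0 scalar_prod_right_zero[of _ n] carrier_vecI)
      finally show False using i by (simp add: unitary_matD(3)[OF U])
    qed
    from pos[OF v this] ip show ?thesis by simp
  qed
  moreover have "dim_row A = n" using carrier_matD[OF A] by simp
  ultimately have "psd_diagonalization A U d"
    using U A_eq unfolding psd_diagonalization_def by (metis less_imp_le)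
  with dpos show ?thesis by blast
qed

lemma positive_definite_powr:
  assumes "positive_definite_mat n A"
  obtains U d where "unitary_mat n U" "\<And>i. i < n \<Longrightarrow> 0 < d i"
    "\<And>t. mat_powr A t = U * mat_diag n (\<lambda>i. complex_of_real (d i powr t)) * mat_adjoint U"
proof -
  obtain U d where d: "psd_diagonalization A U d" "\<forall>i<n. 0 < d i"
    using positive_definite_diagonalization[OF assms] by blast
  have A: "A \<in> carrier_mat n n" using assms by (simp add: positive_definite_mat_def)
  show thesis
    by (rule that[OF psd_diagonalizationD(1)[OF d(1) A], of d])
      (use d(2) mat_powr_eq[OF d(1)] carrier_matD(1)[OF A] in auto)
qed

context
  fixes n :: nat and A :: "complex mat"
  assumes A: "positive_definite_mat n A"
begin

lemma mat_powr_carrier: "mat_powr A t \<in> carrier_mat n n"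
  and mat_powr_hermitian: "mat_adjoint (mat_powr A t) = mat_powr A t"
  and mat_powr_add: "mat_powr A s * mat_powr A t = mat_powr A (s + t)"
  and mat_powr_zero: "mat_powr A 0 = 1\<^sub>m n"
proof -
  obtain U d where U: "unitary_mat n U" and d: "\<And>i. i < n \<Longrightarrow> 0 < d i"
    and p: "\<And>t. mat_powr A t = U * mat_diag n (\<lambda>i. complex_of_real (d i powr t)) * mat_adjoint U"
    using positive_definite_powr[OF A] by blast
  note [simp] = unitary_matD(1,2)[OF U]
  show "mat_powr A t \<in> carrier_mat n n" by (simp add: p)
  show "mat_adjoint (mat_powr A t) = mat_powr A t"
    by (simp add: p mat_adjoint_mult[of _ n n _ n] assoc_mult_mat[of _ n n _ n _ n])
  have diag: "mat_diag n (\<lambda>i. complex_of_real (d i powr s)) * mat_diag n (\<lambda>i. complex_of_real (d i powr t)) =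
      mat_diag n (\<lambda>i. complex_of_real (d i powr (s + t)))"
    by (simp add: powr_add)
  have "mat_powr A s * mat_powr A t =
      U * (mat_diag n (\<lambda>i. complex_of_real (d i powr s)) * mat_diag n (\<lambda>i. complex_of_real (d i powr t))) * mat_adjoint U"
    unfolding p by (simp add: assoc_mult_mat[of _ n n _ n _ n] unitary_cancel[OF U, where m = n] del: mat_diag_diag)
  then show "mat_powr A s * mat_powr A t = mat_powr A (s + t)" by (simp only: diag p)
  have "mat_diag n (\<lambda>i. complex_of_real (d i powr 0)) = 1\<^sub>m n"
    using d by (intro eq_matI) (auto simp: mat_diag_def less_imp_neq[symmetric])
  then show "mat_powr A 0 = 1\<^sub>m n"
    unfolding p by (simp add: right_mult_one_mat[of _ n n] unitary_matD(4)[OF U])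
qed

end

section \<open>A crude bound for singular values\<close>

text \<open>A submultiplicative size of matrices that is invariant under adjoints. It only serves to show that
\<open>\<phi>\<close> is bounded on \<open>[0, 1]\<close>, so the constants below are far from optimal.\<close>
definition entry_sum :: "complex mat \<Rightarrow> real" where
  "entry_sum M = (\<Sum>i<dim_row M. \<Sum>j<dim_col M. cmod (M $$ (i, j)))"

lemma entry_sum_nonneg: "0 \<le> entry_sum M"
  by (simp add: entry_sum_def sum_nonneg)

lemma entry_sum_mult:
  assumes M: "M \<in> carrier_mat n n" and K: "K \<in> carrier_mat n n"
  shows "entry_sum (M * K) \<le> entry_sum M * entry_sum K"
proof -
  note [simp] = carrier_matD[OF M] carrier_matD[OF K]
  have "entry_sum (M * K) = (\<Sum>i<n. \<Sum>j<n. cmod (\<Sum>l<n. M $$ (i, l) * K $$ (l, j)))"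
    by (simp add: entry_sum_def scalar_prod_def atLeast0LessThan)
  also have "\<dots> \<le> (\<Sum>i<n. \<Sum>j<n. \<Sum>l<n. cmod (M $$ (i, l)) * cmod (K $$ (l, j)))"
    by (intro sum_mono) (rule order_trans[OF norm_sum], simp add: norm_mult)
  also have "\<dots> = (\<Sum>i<n. \<Sum>l<n. cmod (M $$ (i, l)) * (\<Sum>j<n. cmod (K $$ (l, j))))"
    by (subst sum.swap) (simp add: sum_distrib_left)
  also have "\<dots> \<le> (\<Sum>i<n. \<Sum>l<n. cmod (M $$ (i, l)) * entry_sum K)"
  proof (intro sum_mono mult_left_mono)
    fix l assume l: "l \<in> {..<n}"
    show "(\<Sum>j<n. cmod (K $$ (l, j))) \<le> entry_sum K"
      unfolding entry_sum_def using l
      by (simp add: member_le_sum[of l "{..<n}" "\<lambda>l. \<Sum>j<n. cmod (K $$ (l, j))"] sum_nonneg)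
  qed simp
  also have "\<dots> = entry_sum M * entry_sum K"
    by (simp add: entry_sum_def sum_distrib_right)
  finally show ?thesis .
qed

lemma entry_sum_adjoint: "entry_sum (mat_adjoint M) = entry_sum M"
proof -
  have "entry_sum (mat_adjoint M) = (\<Sum>i<dim_col M. \<Sum>j<dim_row M. cmod (M $$ (j, i)))"
    by (simp add: entry_sum_def mat_adjoint_index[of _ "dim_row M" "dim_col M"])
  then show ?thesis unfolding entry_sum_def by (subst sum.swap) simp
qed

lemma entry_sum_mult3:
  assumes "M \<in> carrier_mat n n" "K \<in> carrier_mat n n" "L \<in> carrier_mat n n"
  shows "entry_sum (M * K * L) \<le> entry_sum M * entry_sum K * entry_sum L"
  using entry_sum_mult[of "M * K" n L] entry_sum_mult[of M n K] assms
    mult_right_mono[OF _ entry_sum_nonneg[of L]] by (meson order_trans square_mult_carrier)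

lemma entry_sum_diag: "entry_sum (mat_diag n f) = (\<Sum>i<n. cmod (f i))"
proof -
  have "entry_sum (mat_diag n f) = (\<Sum>i<n. \<Sum>j<n. if j = i then cmod (f i) else 0)"
    unfolding entry_sum_def
    by (rule sum.cong, simp add: mat_diag_def, rule sum.cong) (auto simp: mat_diag_def)
  then show ?thesis by simp
qed

lemma entry_sum_unitary:
  assumes U: "unitary_mat n U"
  shows "entry_sum U \<le> (real n)\<^sup>2"
proof -
  note Uc = unitary_matD(1)[OF U]
  have "cmod (U $$ (i, j)) \<le> 1" if ij: "i < n" "j < n" for i j
  proof -
    have "complex_of_real (\<Sum>l<n. (cmod (U $$ (l, j)))\<^sup>2) = complex_of_real 1"
      using adjoint_mult_self_index[OF Uc ij(2)] ij by (simp add: unitary_matD(3)[OF U])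
    then have "(\<Sum>l<n. (cmod (U $$ (l, j)))\<^sup>2) = 1" by (simp only: of_real_eq_iff)
    then have "(cmod (U $$ (i, j)))\<^sup>2 \<le> 1"
      using member_le_sum[of i "{..<n}" "\<lambda>l. (cmod (U $$ (l, j)))\<^sup>2"] ij by simp
    then show ?thesis by (simp add: power_le_one_iff)
  qed
  then have "entry_sum U \<le> (\<Sum>i<n. \<Sum>j<n. 1)"
    unfolding entry_sum_def carrier_matD[OF Uc] by (intro sum_mono) auto
  then show ?thesis by (simp add: power2_eq_square)
qed

text \<open>The eigenvalues are the entries of \<open>U* (M* M) U\<close>, and a unitary matrix has entries of modulus at most 1.\<close>
lemma singular_value_le_entry_sum:
  assumes M: "M \<in> carrier_mat n n" and d: "psd_diagonalization (mat_adjoint M * M) U d" and i: "i < n"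
  shows "d i \<le> (real n)\<^sup>2 * (entry_sum M * entry_sum M) * (real n)\<^sup>2"
proof -
  have H [simp]: "mat_adjoint M * M \<in> carrier_mat n n" using M by simp
  note D = psd_diagonalizationD[OF d H]
  note [simp] = unitary_matD(1,2)[OF D(1)]
  have "mat_adjoint U * (mat_adjoint M * M) * U = mat_diag n (\<lambda>i. complex_of_real (d i))"
    by (subst D(3)) (simp add: assoc_mult_mat[of _ n n _ n _ n] unitary_cancel[OF D(1), where m = n]
        unitary_matD(3)[OF D(1)] right_mult_one_mat[of _ n n])
  then have "(\<Sum>i<n. \<bar>d i\<bar>) = entry_sum (mat_adjoint U * (mat_adjoint M * M) * U)"
    by (simp add: entry_sum_diag)
  also have "\<dots> \<le> entry_sum (mat_adjoint U) * entry_sum (mat_adjoint M * M) * entry_sum U"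
    by (rule entry_sum_mult3[of _ n]) simp_all
  also have "\<dots> \<le> (real n)\<^sup>2 * (entry_sum M * entry_sum M) * (real n)\<^sup>2"
    using entry_sum_unitary[OF D(1)] entry_sum_mult[of "mat_adjoint M" n M] M
    by (intro mult_mono mult_nonneg_nonneg entry_sum_nonneg) (simp_all add: entry_sum_adjoint entry_sum_nonneg)
  finally have "(\<Sum>i<n. \<bar>d i\<bar>) \<le> (real n)\<^sup>2 * (entry_sum M * entry_sum M) * (real n)\<^sup>2" .
  moreover have "\<bar>d i\<bar> \<le> (\<Sum>i<n. \<bar>d i\<bar>)" using i by (intro member_le_sum) auto
  ultimately show ?thesis by linarith
qed

text \<open>For \<open>0 \<le> t \<le> 1\<close> and \<open>d > 0\<close> the power \<open>d powr t\<close> is at most \<open>max 1 d \<le> 1 + d\<close>, uniformly in \<open>t\<close>.\<close>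
lemma mat_powr_entry_sum_bounded:
  assumes A: "positive_definite_mat n A"
  shows "\<exists>K. \<forall>t. 0 \<le> t \<longrightarrow> t \<le> 1 \<longrightarrow> entry_sum (mat_powr A t) \<le> K"
proof -
  obtain U d where U: "unitary_mat n U" and d: "\<And>i. i < n \<Longrightarrow> 0 < d i"
    and p: "\<And>t. mat_powr A t = U * mat_diag n (\<lambda>i. complex_of_real (d i powr t)) * mat_adjoint U"
    using positive_definite_powr[OF A] by blast
  note [simp] = unitary_matD(1,2)[OF U]
  show ?thesis
  proof (intro exI allI impI)
    fix t :: real assume t: "0 \<le> t" "t \<le> 1"
    have powr_le: "d i powr t \<le> 1 + d i" if "i < n" for i
    proof (cases "d i \<le> 1")
      case True
      then have "d i powr t \<le> 1" using d[OF that] t by (intro powr_le1) auto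
      then show ?thesis using d[OF that] by linarith
    next
      case False
      then have "d i powr t \<le> d i powr 1" using t by (intro powr_mono) auto
      then show ?thesis using d[OF that] by simp
    qed
    have "entry_sum (mat_powr A t) \<le>
        entry_sum U * entry_sum (mat_diag n (\<lambda>i. complex_of_real (d i powr t))) * entry_sum (mat_adjoint U)"
      unfolding p by (rule entry_sum_mult3[of _ n]) simp_all
    also have "\<dots> \<le> entry_sum U * (\<Sum>i<n. 1 + d i) * entry_sum U"
      unfolding entry_sum_adjoint entry_sum_diag
      using powr_le by (intro mult_right_mono mult_left_mono sum_mono entry_sum_nonneg) auto
    finally show "entry_sum (mat_powr A t) \<le> entry_sum U * (\<Sum>i<n. 1 + d i) * entry_sum U" .
  qed
qed

section \<open>The Cauchy-Schwarz inequality for unitarily invariant norms\<close>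

context
  fixes n :: nat and N :: "complex mat \<Rightarrow> real" and r :: real
  assumes N: "unitarily_invariant_norm n N" and r: "0 < r"
begin

lemma norm_abs_powr_eq_gauge:
  assumes Y: "Y \<in> carrier_mat n n" and d: "psd_diagonalization (mat_adjoint Y * Y) U d"
  shows "N (mat_powr (mat_abs Y) r) = diagonal_gauge n N (\<lambda>i. d i powr (r / 2))"
proof -
  have H: "mat_adjoint Y * Y \<in> carrier_mat n n" using Y by simp
  note D = psd_diagonalizationD[OF d H]
  note Uc [simp] = unitary_matD(1,2)[OF D(1)]
  have abs: "mat_abs Y = U * mat_diag n (\<lambda>i. complex_of_real (d i powr (1/2))) * mat_adjoint U"
    unfolding mat_abs_def mat_powr_eq[OF d] carrier_matD[OF H] ..
  have dim: "dim_row (mat_abs Y) = n" using carrier_matD[OF Uc(1)] by (simp add: abs)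
  have "psd_diagonalization (mat_abs Y) U (\<lambda>i. d i powr (1/2))"
    unfolding psd_diagonalization_def dim using D(1) abs by simp
  from mat_powr_eq[OF this, of r]
  have "mat_powr (mat_abs Y) r = U * mat_diag n (\<lambda>i. complex_of_real (d i powr (r / 2))) * mat_adjoint U"
    unfolding dim by (simp add: powr_powr)
  then show ?thesis
    using gauge_unitary[OF N D(1) unitary_mat_adjoint[OF D(1)] mat_diag_dim]
    by (simp add: diagonal_gauge_def)
qed

lemma norm_abs_powr_nonneg:
  assumes Y: "Y \<in> carrier_mat n n"
  shows "0 \<le> N (mat_powr (mat_abs Y) r)"
proof -
  obtain U d where "psd_diagonalization (mat_adjoint Y * Y) U d"
    using adjoint_mult_self_diagonalization[OF Y] by blast
  from norm_abs_powr_eq_gauge[OF Y this] show ?thesis by (simp add: gauge_nonneg[OF N])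
qed

text \<open>Raised to the power \<open>r / 2\<close>, the products in \<open>singular_value_log_majorization\<close> say that the singular
values of \<open>|C Y D|^r\<close> are weakly log-majorized by the geometric means of those of \<open>|C^2 Y|^r\<close> and
\<open>|Y D^2|^r\<close>; the gauge of a vector of geometric means is bounded by \<open>gauge_sqrt_mult_le\<close>.\<close>
theorem norm_Cauchy_Schwarz:
  assumes C: "C \<in> carrier_mat n n" "mat_adjoint C = C"
    and D: "D \<in> carrier_mat n n" "mat_adjoint D = D"
    and D': "D' \<in> carrier_mat n n" "D' * D = 1\<^sub>m n"
    and Y: "Y \<in> carrier_mat n n"
  shows "(N (mat_powr (mat_abs (C * Y * D)) r))\<^sup>2 \<le>
    N (mat_powr (mat_abs (C * C * Y)) r) * N (mat_powr (mat_abs (Y * (D * D))) r)"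
proof -
  have c1: "C * Y * D \<in> carrier_mat n n" and c2: "C * C * Y \<in> carrier_mat n n"
    and c3: "Y * (D * D) \<in> carrier_mat n n" using C D Y by simp_all
  obtain U a where a: "psd_diagonalization (mat_adjoint (C * Y * D) * (C * Y * D)) U a" "decreasing_below n a"
    using decreasing_singular_values[OF c1] .
  obtain V b where b: "psd_diagonalization (mat_adjoint (C * C * Y) * (C * C * Y)) V b" "decreasing_below n b"
    using decreasing_singular_values[OF c2] .
  obtain W c where c: "psd_diagonalization (mat_adjoint (Y * (D * D)) * (Y * (D * D))) W c" "decreasing_below n c"
    using decreasing_singular_values[OF c3] .
  have a0: "0 \<le> a i" if "i < n" for i
    by (rule psd_diagonalizationD(2)[OF a(1) _ that]) (use c1 in simp)
  have b0: "0 \<le> b i" if "i < n" for i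
    by (rule psd_diagonalizationD(2)[OF b(1) _ that]) (use c2 in simp)
  have c0: "0 \<le> c i" if "i < n" for i
    by (rule psd_diagonalizationD(2)[OF c(1) _ that]) (use c3 in simp)
  let ?p = "r / 2"
  let ?y = "\<lambda>i. sqrt (b i powr ?p * c i powr ?p)"
  have "diagonal_gauge n N (\<lambda>i. a i powr ?p) \<le> diagonal_gauge n N ?y"
  proof (rule gauge_le_if_log_majorized[OF N])
    show "0 \<le> a i powr ?p" "0 \<le> ?y i" for i by simp_all
    show "decreasing_below n (\<lambda>i. a i powr ?p)"
      using a(2) a0 r unfolding decreasing_below_def by (auto intro!: powr_mono2)
    fix k assume k: "k \<le> n"
    have "(\<Prod>i<k. a i powr ?p)\<^sup>2 = ((\<Prod>i<k. a i)\<^sup>2) powr ?p"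
      using k a0 by (simp add: prod_powr_distrib powr_mult prod_nonneg power2_eq_square)
    also have "\<dots> \<le> ((\<Prod>i<k. b i) * (\<Prod>i<k. c i)) powr ?p"
      using singular_value_log_majorization[OF C D D' Y a(1) b c k] r by (intro powr_mono2) auto
    also have "\<dots> = (\<Prod>i<k. b i powr ?p) * (\<Prod>i<k. c i powr ?p)"
      using k b0 c0 by (simp add: prod_powr_distrib powr_mult prod_nonneg)
    also have "\<dots> = (\<Prod>i<k. (?y i)\<^sup>2)" by (simp add: prod.distrib)
    also have "\<dots> = (\<Prod>i<k. ?y i)\<^sup>2" by (simp only: prod_power_distrib)
    finally show "(\<Prod>i<k. a i powr ?p) \<le> (\<Prod>i<k. ?y i)"
      by (rule power2_le_imp_le) (simp add: prod_nonneg)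
  qed
  then have "(diagonal_gauge n N (\<lambda>i. a i powr ?p))\<^sup>2 \<le> (diagonal_gauge n N ?y)\<^sup>2"
    by (intro power_mono gauge_nonneg[OF N])
  also have "\<dots> \<le> diagonal_gauge n N (\<lambda>i. b i powr ?p) * diagonal_gauge n N (\<lambda>i. c i powr ?p)"
    by (rule gauge_sqrt_mult_le[OF N]) simp_all
  finally show ?thesis
    using norm_abs_powr_eq_gauge[OF c1 a(1)] norm_abs_powr_eq_gauge[OF c2 b(1)]
      norm_abs_powr_eq_gauge[OF c3 c(1)] by simp
qed

lemma norm_abs_powr_bounded:
  "\<exists>L. \<forall>Y \<in> carrier_mat n n. entry_sum Y \<le> K \<longrightarrow> N (mat_powr (mat_abs Y) r) \<le> L"
proof (intro exI ballI impI)
  let ?K = "(real n)\<^sup>2 * (K * K) * (real n)\<^sup>2"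
  fix Y assume Y: "Y \<in> carrier_mat n n" and YK: "entry_sum Y \<le> K"
  obtain U d where d: "psd_diagonalization (mat_adjoint Y * Y) U d"
    using adjoint_mult_self_diagonalization[OF Y] by blast
  have "d i powr (r / 2) \<le> ?K powr (r / 2)" if i: "i < n" for i
  proof (rule powr_mono2)
    show "0 \<le> d i" by (rule psd_diagonalizationD(2)[OF d _ i]) (use Y in simp)
    have "entry_sum Y * entry_sum Y \<le> K * K"
      using YK entry_sum_nonneg[of Y] by (intro mult_mono) auto
    then show "d i \<le> ?K"
      by (intro order_trans[OF singular_value_le_entry_sum[OF Y d i]] mult_right_mono mult_left_mono) auto
  qed (use r in simp)
  then show "N (mat_powr (mat_abs Y) r) \<le> diagonal_gauge n N (\<lambda>i. ?K powr (r / 2))"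
    unfolding norm_abs_powr_eq_gauge[OF Y d] by (intro gauge_mono[OF N]) auto
qed

end

section \<open>Convexity\<close>

text \<open>The theorem of Bernstein and Doetsch. The excess \<open>h\<close> of \<open>g\<close> over its chord is midpoint convex and vanishes
at both ends. Every point is the midpoint of an end and another point of the interval, so any upper
bound of \<open>h\<close> may be halved, again and again.\<close>
lemma bounded_midpoint_convex_below_chord:
  fixes g :: "real \<Rightarrow> real"
  assumes ab: "a \<le> b"
    and mid: "\<And>s t. s \<in> {a..b} \<Longrightarrow> t \<in> {a..b} \<Longrightarrow> g ((s + t) / 2) \<le> (g s + g t) / 2"
    and bound: "\<And>t. t \<in> {a..b} \<Longrightarrow> g t \<le> K"
    and x: "0 \<le> x" "x \<le> 1"
  shows "g ((1 - x) * a + x * b) \<le> (1 - x) * g a + x * g b"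
proof -
  define p where "p x = (1 - x) * a + x * b" for x
  define h where "h x = g (p x) - ((1 - x) * g a + x * g b)" for x
  have p: "p x \<in> {a..b}" if "0 \<le> x" "x \<le> 1" for x
  proof -
    have "0 \<le> x * (b - a)" "0 \<le> (1 - x) * (b - a)" using that ab by simp_all
    then show ?thesis by (simp add: p_def algebra_simps)
  qed
  have h_mid: "h ((x + y) / 2) \<le> (h x + h y) / 2" if "0 \<le> x" "x \<le> 1" "0 \<le> y" "y \<le> 1" for x y
  proof -
    have "p ((x + y) / 2) = (p x + p y) / 2" by (simp add: p_def field_simps)
    then show ?thesis
      unfolding h_def using mid[OF p p, of x y] that by (simp only:) (simp add: field_simps)
  qed
  have h01: "h 0 = 0" "h 1 = 0" by (simp_all add: h_def p_def)
  define M where "M = \<bar>K\<bar> + \<bar>g a\<bar> + \<bar>g b\<bar>"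
  have M0: "0 \<le> M" by (simp add: M_def)
  have "h x \<le> M / 2 ^ j" if "0 \<le> x" "x \<le> 1" for x j
    using that
  proof (induction j arbitrary: x)
    case 0
    have "\<bar>(1 - x) * g a\<bar> \<le> 1 * \<bar>g a\<bar>" "\<bar>x * g b\<bar> \<le> 1 * \<bar>g b\<bar>"
      using 0 by (auto simp: abs_mult intro!: mult_left_le_one_le)
    then show ?case using bound[OF p[OF 0]] by (simp add: h_def M_def)
  next
    case (Suc j)
    show ?case
    proof (cases "x \<le> 1 / 2")
      case True
      have "h x \<le> (h 0 + h (2 * x)) / 2" using h_mid[of 0 "2 * x"] Suc.prems True by simp
      also have "\<dots> \<le> M / 2 ^ Suc j" using Suc.IH[of "2 * x"] Suc.prems True by (simp add: h01)
      finally show ?thesis .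
    next
      case False
      have "h x \<le> (h 1 + h (2 * x - 1)) / 2" using h_mid[of 1 "2 * x - 1"] Suc.prems False by simp
      also have "\<dots> \<le> M / 2 ^ Suc j" using Suc.IH[of "2 * x - 1"] Suc.prems False by (simp add: h01)
      finally show ?thesis .
    qed
  qed
  then have "h x \<le> M * (1 / 2) ^ j" for j using x by (simp add: power_one_over)
  moreover have "(\<lambda>j. M * (1 / 2) ^ j) \<longlonglongrightarrow> M * 0"
    by (intro tendsto_mult tendsto_const LIMSEQ_power_zero) simp
  ultimately have "h x \<le> M * 0" by (intro LIMSEQ_le_const[of _ "M * 0" "h x"]) auto
  then show ?thesis by (simp add: h_def p_def)
qed

context
  fixes n :: nat and A B X :: "complex mat" and r :: real and N :: "complex mat \<Rightarrow> real"
  assumes A: "positive_definite_mat n A" and B: "positive_definite_mat n B"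
    and X: "X \<in> carrier_mat n n" and r: "0 < r" and N: "unitarily_invariant_norm n N"
begin

lemma powr_product_carrier: "mat_powr A u * X * mat_powr B v \<in> carrier_mat n n"
  using mat_powr_carrier[OF A] mat_powr_carrier[OF B] X by simp

text \<open>Apply \<open>norm_Cauchy_Schwarz\<close> to \<open>C = A^h\<close>, \<open>D = B^h\<close> and \<open>Y = A^s X B^(1-t)\<close> with \<open>h = (t - s)/2\<close>. The
order of \<open>s\<close> and \<open>t\<close> is immaterial because negative powers exist.\<close>
lemma factor_midpoint_log_convex:
  "(N (mat_powr (mat_abs (mat_powr A ((s + t) / 2) * X * mat_powr B (1 - (s + t) / 2))) r))\<^sup>2 \<le>
    N (mat_powr (mat_abs (mat_powr A s * X * mat_powr B (1 - s))) r) *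
    N (mat_powr (mat_abs (mat_powr A t * X * mat_powr B (1 - t))) r)"
proof -
  note [simp] = mat_powr_carrier[OF A] mat_powr_carrier[OF B] X
  define h where "h = (t - s) / 2"
  define Y where "Y = mat_powr A s * X * mat_powr B (1 - t)"
  have Y: "Y \<in> carrier_mat n n" by (simp add: Y_def)
  have powA: "mat_powr A u * (mat_powr A v * Z) = mat_powr A (u + v) * Z" if "Z \<in> carrier_mat n n" for u v Z
    using that by (simp flip: assoc_mult_mat[of _ n n _ n _ n] add: mat_powr_add[OF A])
  have prod: "mat_powr A u * Y * mat_powr B v = mat_powr A (u + s) * X * mat_powr B (1 - t + v)" for u v
    unfolding Y_def by (simp add: assoc_mult_mat[of _ n n _ n _ n] powA mat_powr_add[OF B])
  have 1: "mat_powr A h * Y * mat_powr B h = mat_powr A ((s + t) / 2) * X * mat_powr B (1 - (s + t) / 2)"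
    unfolding prod by (simp add: h_def field_simps)
  have 2: "mat_powr A h * mat_powr A h * Y = mat_powr A t * X * mat_powr B (1 - t)"
    using prod[of "h + h" 0] Y
    by (simp add: mat_powr_add[OF A] mat_powr_zero[OF B] right_mult_one_mat[of _ n n] h_def field_simps)
  have 3: "Y * (mat_powr B h * mat_powr B h) = mat_powr A s * X * mat_powr B (1 - s)"
  proof -
    have "1 - t + (h + h) = 1 - s" by (simp add: h_def field_simps)
    with prod[of 0 "h + h"]
    have "mat_powr A 0 * Y * mat_powr B (h + h) = mat_powr A s * X * mat_powr B (1 - s)"
      by (simp only: add_0)
    then show ?thesis
      using Y by (simp add: mat_powr_add[OF B] mat_powr_zero[OF A] left_mult_one_mat[of _ n n])
  qed
  have inv: "mat_powr B (- h) * mat_powr B h = 1\<^sub>m n"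
    by (simp add: mat_powr_add[OF B] mat_powr_zero[OF B])
  show ?thesis
    using norm_Cauchy_Schwarz[OF N r mat_powr_carrier[OF A] mat_powr_hermitian[OF A]
        mat_powr_carrier[OF B] mat_powr_hermitian[OF B] mat_powr_carrier[OF B] inv Y, of h]
    unfolding 1 2 3 by (simp add: mult.commute)
qed

lemma phi_midpoint_convex: "phi N A B X r ((s + t) / 2) \<le> (phi N A B X r s + phi N A B X r t) / 2"
proof -
  define f where "f u = N (mat_powr (mat_abs (mat_powr A u * X * mat_powr B (1 - u))) r)" for u
  have f0: "0 \<le> f u" for u
    unfolding f_def by (rule norm_abs_powr_nonneg[OF N r powr_product_carrier])
  have phi: "phi N A B X r u = f u * f (1 - u)" for u by (simp add: phi_def f_def)
  have f: "(f ((s + t) / 2))\<^sup>2 \<le> f s * f t" for s t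
    using factor_midpoint_log_convex by (simp add: f_def)
  have "1 - (s + t) / 2 = ((1 - s) + (1 - t)) / 2" by (simp add: field_simps)
  then have f': "(f (1 - (s + t) / 2))\<^sup>2 \<le> f (1 - s) * f (1 - t)" using f by (simp only:)
  have "(f ((s + t) / 2) * f (1 - (s + t) / 2))\<^sup>2 \<le> (f s * f t) * (f (1 - s) * f (1 - t))"
    using f[of s t] f' unfolding power_mult_distrib by (intro mult_mono) (simp_all add: f0)
  then have "(phi N A B X r ((s + t) / 2))\<^sup>2 \<le> phi N A B X r s * phi N A B X r t"
    by (simp add: phi mult_ac)
  then have "phi N A B X r ((s + t) / 2) \<le> sqrt (phi N A B X r s * phi N A B X r t)"
    by (rule real_le_rsqrt)
  also have "\<dots> \<le> (phi N A B X r s + phi N A B X r t) / 2"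
    by (rule arith_geo_mean_sqrt) (simp_all add: phi f0)
  finally show ?thesis .
qed

lemma phi_bounded: "\<exists>K. \<forall>t \<in> {0..1}. phi N A B X r t \<le> K"
proof -
  obtain K1 where K1: "\<And>t. 0 \<le> t \<Longrightarrow> t \<le> 1 \<Longrightarrow> entry_sum (mat_powr A t) \<le> K1"
    using mat_powr_entry_sum_bounded[OF A] by blast
  obtain K2 where K2: "\<And>t. 0 \<le> t \<Longrightarrow> t \<le> 1 \<Longrightarrow> entry_sum (mat_powr B t) \<le> K2"
    using mat_powr_entry_sum_bounded[OF B] by blast
  obtain L where L: "\<And>Y. Y \<in> carrier_mat n n \<Longrightarrow> entry_sum Y \<le> K1 * entry_sum X * K2 \<Longrightarrow>
      N (mat_powr (mat_abs Y) r) \<le> L"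
    using norm_abs_powr_bounded[OF N r] by blast
  have f: "N (mat_powr (mat_abs (mat_powr A u * X * mat_powr B v)) r) \<le> L"
    if "0 \<le> u" "u \<le> 1" "0 \<le> v" "v \<le> 1" for u v
  proof (rule L[OF powr_product_carrier])
    have "0 \<le> K1" using K1[of 0] entry_sum_nonneg[of "mat_powr A 0"] by simp
    have "entry_sum (mat_powr A u * X * mat_powr B v) \<le>
        entry_sum (mat_powr A u) * entry_sum X * entry_sum (mat_powr B v)"
      by (rule entry_sum_mult3[OF mat_powr_carrier[OF A] X mat_powr_carrier[OF B]])
    also have "\<dots> \<le> K1 * entry_sum X * K2"
      using that K1[of u] K2[of v] \<open>0 \<le> K1\<close> by (intro mult_mono mult_nonneg_nonneg entry_sum_nonneg) auto
    finally show "entry_sum (mat_powr A u * X * mat_powr B v) \<le> K1 * entry_sum X * K2" .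
  qed
  have "phi N A B X r t \<le> L * L" if "t \<in> {0..1}" for t
  proof -
    have "0 \<le> L"
      using f[of 0 0] norm_abs_powr_nonneg[OF N r powr_product_carrier[of 0 0]] by simp
    then show ?thesis
      unfolding phi_def using that f[of t "1 - t"] f[of "1 - t" t]
      by (intro mult_mono norm_abs_powr_nonneg[OF N r powr_product_carrier]) auto
  qed
  then show ?thesis by blast
qed

lemma phi_below_chord:
  assumes ab: "0 \<le> a" "a \<le> b" "b \<le> 1" and x: "0 \<le> x" "x \<le> 1"
  shows "phi N A B X r ((1 - x) * a + x * b) \<le> (1 - x) * phi N A B X r a + x * phi N A B X r b"
proof -
  obtain K where K: "\<And>t. t \<in> {0..1} \<Longrightarrow> phi N A B X r t \<le> K" using phi_bounded by blast
  show ?thesis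
    by (rule bounded_midpoint_convex_below_chord[OF ab(2) phi_midpoint_convex _ x, where K = K])
      (use K ab in auto)
qed

end

theorem theorem6p1:
  fixes n :: nat and A B X :: "complex mat" and r t :: real
    and N :: "complex mat \<Rightarrow> real"
  assumes "positive_definite_mat n A"
    and "positive_definite_mat n B"
    and "X \<in> carrier_mat n n"
    and "0 < r"
    and "unitarily_invariant_norm n N"
    and "0 \<le> t" and "t \<le> 1"
  shows "let \<phi> = phi N A B X r; t0 = min t (1 - t); lmin = min (1 - 2 * t0) (2 * t0) in
      \<phi> t \<le> \<phi> t + lmin * ((\<phi> (1/2) + \<phi> 0) / 2 - \<phi> (1/4)) \<and>
      \<phi> t + lmin * ((\<phi> (1/2) + \<phi> 0) / 2 - \<phi> (1/4)) \<le> (1 - 2 * t0) * \<phi> 0 + 2 * t0 * \<phi> (1/2)"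
proof -
  let ?\<phi> = "phi N A B X r"
  define t0 where "t0 = min t (1 - t)"
  define gap where "gap = (?\<phi> (1/2) + ?\<phi> 0) / 2 - ?\<phi> (1/4)"
  define lmin where "lmin = min (1 - 2 * t0) (2 * t0)"
  note chord = phi_below_chord[OF assms(1-5)]
  have t0: "0 \<le> t0" "t0 \<le> 1/2" using assms(6,7) by (auto simp: t0_def min_def)
  have sym: "?\<phi> t = ?\<phi> t0" by (simp add: t0_def min_def phi_def mult.commute)
  have gap: "0 \<le> gap"
    using phi_midpoint_convex[OF assms(1-5), of 0 "1/2"] by (simp add: gap_def)
  have "0 \<le> lmin" using t0 by (simp add: lmin_def)
  then have lower: "0 \<le> lmin * gap" using gap by simp
  have upper: "?\<phi> t0 + lmin * gap \<le> (1 - 2 * t0) * ?\<phi> 0 + 2 * t0 * ?\<phi> (1/2)"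
  proof (cases "t0 \<le> 1/4")
    case True
    then have l: "lmin = 2 * t0" by (simp add: lmin_def min_def)
    have "?\<phi> t0 \<le> (1 - 4 * t0) * ?\<phi> 0 + 4 * t0 * ?\<phi> (1/4)"
      using chord[of 0 "1/4" "4 * t0"] t0 True by simp
    \<comment> \<open>The chord over \<open>[0, 1/4]\<close> leaves room for twice the claimed improvement.\<close>
    moreover have "(1 - 4 * t0) * ?\<phi> 0 + 4 * t0 * ?\<phi> (1/4) + 2 * (2 * t0 * gap) =
        (1 - 2 * t0) * ?\<phi> 0 + 2 * t0 * ?\<phi> (1/2)"
      by (simp add: gap_def field_simps)
    moreover have "0 \<le> 2 * t0 * gap" using t0 gap by simp
    ultimately show ?thesis unfolding l by linarith
  next
    case False
    then have l: "lmin = 1 - 2 * t0" by (simp add: lmin_def min_def)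
    have "(1 - (4 * t0 - 1)) * (1/4) + (4 * t0 - 1) * (1/2) = t0" by (simp add: field_simps)
    then have "?\<phi> t0 \<le> (1 - (4 * t0 - 1)) * ?\<phi> (1/4) + (4 * t0 - 1) * ?\<phi> (1/2)"
      using chord[of "1/4" "1/2" "4 * t0 - 1"] t0 False by simp
    moreover have "(1 - (4 * t0 - 1)) * ?\<phi> (1/4) + (4 * t0 - 1) * ?\<phi> (1/2) + 2 * ((1 - 2 * t0) * gap) =
        (1 - 2 * t0) * ?\<phi> 0 + 2 * t0 * ?\<phi> (1/2)"
      by (simp add: gap_def field_simps)
    moreover have "0 \<le> (1 - 2 * t0) * gap" using t0 gap by simp
    ultimately show ?thesis unfolding l by linarith
  qed
  show ?thesis
    unfolding Let_def using lower upper sym by (simp add: lmin_def gap_def t0_def)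
qed

end
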